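(* The interpretation in $\mathbb T$ of every Skolem function belongs to $K^{\uparrow}+\mathbb N$. Thus it has no monomials below $1$ in its support, and its constant term is a nonnegative integer.
   Context: $\mathrm{Sk}$ (the Skolem functions) is the smallest set of germs at $+\infty$ of positive real functions containing the constant $1$ and the identity $x$ and closed under addition, multiplication and exponentiation $(f,g)\mapsto f^g$, ordered by eventual comparison. $\mathbb N=\{0,1,2,\dots\}$. $\mathbb T$ is the standard ordered exponential field of well-based logarithmic-exponential series over $\mathbb R$ (van den Dries–Macintyre–Marker), with positive infinite formal variable $x$. It is an elementary extension of $\mathbb R_{\exp}$; $u^v=\exp(v\log u)$ for $u>0$. Skolem germs are interpreted in $\mathbb T$ by sending the identity germ to the formal $x$; this preserves order, addition, multiplication and exponentiation. $\mathbb T$ has an ordered multiplicative monomial group $\mathfrak M$, containing $x$ and $\log x$, and every element of $\mathbb T$ has a unique Hahn expansion with real coefficients and reverse-well-ordered support in $\mathfrak M$; distinct monomials lie in distinct Archimedean classes. With $y=\log x$ there are increasing monomial groups $\mathfrak M_h(y)\subseteq\mathfrak M$ ($h\ge0$), $\mathfrak M_0(y)=y^{\mathbb R}$, such that the full Hahn fields $T_h(y)=\mathbb R((\mathfrak M_h(y)))$ are contained in $\mathbb T$ and $\exp(T_h(y)^{\uparrow})\subseteq\mathfrak M_{h+1}(y)$. For an additive space $V$ of series, $V^{\uparrow}$ is the subspace of series supported strictly above the monomial $1$ (it includes $0$ and series of either sign). Define recursively inside $\mathbb T$ $$G_0=x^{\mathbb Z},\quad K_n=\mathbb R((G_n)),\quad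 G_{n+1}=\{\exp(\gamma)\,x^{\vartheta+k}:\gamma,\vartheta\in K_n^{\uparrow},\ k\in\mathbb Z\},\quad G=\bigcup_{n\ge0}G_n,\quad K=\bigcup_{n\ge0}K_n.$$ Here $\mathbb R((G_n))$ is the set of all Hahn series with real coefficients and reverse-well-ordered support in $G_n$; one has $G_n\subseteq\mathfrak M_{n+1}(y)$ and $K_n\subseteq T_{n+1}(y)$, so these fields exist inside $\mathbb T$, and the $G_n,K_n$ increase with $n$. *)

theory Defs
  imports Complex_Main "HOL-Library.Countable_Set_Type"
begin

section \<open>Skolem functions\<close>

quotient_type germ = "real \<Rightarrow> real" / "\<lambda>f g. eventually (\<lambda>x. f x = g x) at_top"
proof (rule equivpI)
  show "reflp (\<lambda>f g :: real \<Rightarrow> real. eventually (\<lambda>x. f x = g x) at_top)"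
    by (simp add: reflp_def)
  show "symp (\<lambda>f g :: real \<Rightarrow> real. eventually (\<lambda>x. f x = g x) at_top)"
    by (simp add: symp_def eq_commute)
  show "transp (\<lambda>f g :: real \<Rightarrow> real. eventually (\<lambda>x. f x = g x) at_top)"
    by (auto intro!: transpI elim: eventually_elim2)
qed

lift_definition germ_one :: germ is "\<lambda>_. 1" .

lift_definition germ_id :: germ is "\<lambda>x. x" .

lift_definition germ_add :: "germ \<Rightarrow> germ \<Rightarrow> germ" is "\<lambda>f g x. f x + g x"
  by (auto elim: eventually_elim2)

lift_definition germ_mult :: "germ \<Rightarrow> germ \<Rightarrow> germ" is "\<lambda>f g x. f x * g x"
  by (auto elim: eventually_elim2)

lift_definition germ_pow :: "germ \<Rightarrow> germ \<Rightarrow> germ" is "\<lambda>f g x. f x powr g x"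
  by (auto elim: eventually_elim2)

lift_definition germ_pos :: "germ \<Rightarrow> bool" is "\<lambda>f. eventually (\<lambda>x. f x > 0) at_top"
  by (rule iffI; erule (1) eventually_elim2; simp)

inductive_set Sk :: "germ set" where
  one: "germ_one \<in> Sk"
| id: "germ_id \<in> Sk"
| add: "f \<in> Sk \<Longrightarrow> g \<in> Sk \<Longrightarrow> germ_add f g \<in> Sk"
| mult: "f \<in> Sk \<Longrightarrow> g \<in> Sk \<Longrightarrow> germ_mult f g \<in> Sk"
| pow: "f \<in> Sk \<Longrightarrow> g \<in> Sk \<Longrightarrow> germ_pow f g \<in> Sk"

text \<open>Skolem germs are positive, so \<^const>\<open>powr\<close> is genuine exponentiation on them.\<close>

lemma Sk_pos: "f \<in> Sk \<Longrightarrow> germ_pos f"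
proof (induction rule: Sk.induct)
  case one
  show ?case by transfer simp
next
  case id
  show ?case by transfer (rule eventually_gt_at_top)
next
  case (add f g)
  from add(3,4) show ?case
    by transfer (erule (1) eventually_elim2, simp)
next
  case (mult f g)
  from mult(3,4) show ?case
    by transfer (erule (1) eventually_elim2, simp)
next
  case (pow f g)
  from pow(3) show ?case
    by transfer (erule eventually_mono, simp)
qed


section \<open>Logarithmic-exponential monomials and series\<close>

text \<open>
  Every LE-monomial is \<open>exp f\<close> for a unique purely infinite LE-series \<open>f\<close>. The monomials
  \<open>LogX k\<close> (the \<open>k\<close>-fold iterated logarithm of \<open>x\<close>, with \<open>LogX 0\<close> the variable \<open>x\<close> itself)
  are atoms, and every other monomial is \<open>ExpS C\<close>, where \<open>C\<close> is the set of pairs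
  (monomial, nonzero coefficient) of its logarithm \<open>f\<close>. The form \<open>ExpS C\<close> is never used when
  \<open>f\<close> is the single term \<open>LogX (Suc k)\<close>, since \<open>exp (LogX (Suc k)) = LogX k\<close>.

  Countable graphs suffice. Call an ordered set short if all its well-ordered and all its
  reverse-well-ordered subsets are countable. The real line is short, and if \<open>S\<close> is short then
  so is the Hahn space over \<open>S\<close> with its lexicographic order. By induction all monomial groups
  \<open>LEmon k h\<close> below are short, so that every reverse-well-ordered subset of them is countable.

  The datatype also has elements that are not LE-monomials. The LE-monomials are
  the members of the sets \<open>LEmon k h\<close>, and the operations below are only meaningful there.
\<close>

datatype mono = LogX nat | ExpS "(mono \<times> real) cset"

type_synonym series = "mono \<Rightarrow> real"

definition supp :: "series \<Rightarrow> mono set" where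
  "supp f = {m. f m \<noteq> 0}"

definition mon :: "mono \<Rightarrow> series" where
  "mon m = (\<lambda>n. if n = m then 1 else 0)"

definition graph_of :: "series \<Rightarrow> (mono \<times> real) cset" where
  "graph_of f = acset {(m, f m) | m. m \<in> supp f}"

definition of_graph :: "(mono \<times> real) cset \<Rightarrow> series" where
  "of_graph C = (\<lambda>m. if \<exists>!c. (m, c) \<in> rcset C then THE c. (m, c) \<in> rcset C else 0)"

fun mlog :: "mono \<Rightarrow> series" where
  "mlog (LogX k) = mon (LogX (Suc k))"
| "mlog (ExpS C) = of_graph C"

definition mexp :: "series \<Rightarrow> mono" where
  "mexp f = (if \<exists>k. f = mon (LogX (Suc k)) then LogX (THE k. f = mon (LogX (Suc k)))
             else ExpS (graph_of f))"

text \<open>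
  \<open>m \<prec> n\<close> holds iff \<open>mlog n - mlog m\<close> has positive leading coefficient. In the second rule \<open>p\<close> is
  the leading monomial of that difference. The first rule starts the recursion, which would
  otherwise not terminate on iterated logarithms.
\<close>

inductive mless :: "mono \<Rightarrow> mono \<Rightarrow> bool" (infix "\<prec>" 50) where
  log: "i < j \<Longrightarrow> LogX j \<prec> LogX i"
| exp: "mlog m p < mlog n p \<Longrightarrow> (\<And>q. mlog m q \<noteq> mlog n q \<Longrightarrow> q \<noteq> p \<Longrightarrow> q \<prec> p) \<Longrightarrow> m \<prec> n"

definition mone :: mono where
  "mone = mexp (\<lambda>_. 0)"

definition mmult :: "mono \<Rightarrow> mono \<Rightarrow> mono" where
  "mmult m n = mexp (\<lambda>p. mlog m p + mlog n p)"

definition minv :: "mono \<Rightarrow> mono" where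
  "minv m = mexp (\<lambda>p. - mlog m p)"

definition rev_well_ordered :: "mono set \<Rightarrow> bool" where
  "rev_well_ordered A \<longleftrightarrow> (\<forall>B\<subseteq>A. B \<noteq> {} \<longrightarrow> (\<exists>b\<in>B. \<forall>a\<in>B. a = b \<or> a \<prec> b))"

definition Hahn :: "mono set \<Rightarrow> series set" where
  "Hahn A = {f. supp f \<subseteq> A \<and> rev_well_ordered (supp f)}"

definition pure_inf :: "series set \<Rightarrow> series set" where
  "pure_inf V = {f \<in> V. \<forall>m\<in>supp f. mone \<prec> m}"

text \<open>
  With \<open>y = LogX k\<close>, the group \<open>LEmon k h\<close> is \<open>\<MM>\<^sub>h(y)\<close>:
  \<open>\<MM>\<^sub>0(y) = y\<^sup>\<real>\<close> and \<open>\<MM>\<^sub>h\<^sub>+\<^sub>1(y) = y\<^sup>\<real> exp(T\<^sub>h(y)\<up>)\<close> with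
  \<open>T\<^sub>h(y) = \<real>((\<MM>\<^sub>h(y)))\<close>. Powers of \<open>y\<close> are written as \<open>y\<^sup>r = exp (r log y)\<close>, \<open>log y = LogX (Suc k)\<close>.
\<close>

primrec LEmon :: "nat \<Rightarrow> nat \<Rightarrow> mono set" where
  "LEmon k 0 = {mexp (\<lambda>p. r * mon (LogX (Suc k)) p) | r. True}"
| "LEmon k (Suc h) = {mexp (\<lambda>p. r * mon (LogX (Suc k)) p + f p) | r f. f \<in> pure_inf (Hahn (LEmon k h))}"

definition LE :: "series set" where
  "LE = (\<Union>k. \<Union>h. Hahn (LEmon k h))"


section \<open>Operations on LE-series\<close>

definition sconst :: "real \<Rightarrow> series" where
  "sconst c = (\<lambda>m. c * mon mone m)"

definition sX :: series where
  "sX = mon (LogX 0)"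

definition sadd :: "series \<Rightarrow> series \<Rightarrow> series" (infixl "\<oplus>" 65) where
  "f \<oplus> g = (\<lambda>m. f m + g m)"

definition smult :: "series \<Rightarrow> series \<Rightarrow> series" (infixl "\<otimes>" 70) where
  "f \<otimes> g = (\<lambda>m. \<Sum>(a, b) \<in> {(a, b). a \<in> supp f \<and> b \<in> supp g \<and> mmult a b = m}. f a * g b)"

primrec spower :: "series \<Rightarrow> nat \<Rightarrow> series" where
  "spower f 0 = mon mone"
| "spower f (Suc j) = f \<otimes> spower f j"

text \<open>
  Value at an infinitesimal series \<open>e\<close> of the power series with coefficients \<open>c\<close>. For LE-series \<open>e\<close>
  each monomial lies in the support of only finitely many powers of \<open>e\<close> (Neumann's lemma),
  so the real series below has only finitely many nonzero terms.
\<close>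

definition spowser :: "(nat \<Rightarrow> real) \<Rightarrow> series \<Rightarrow> series" where
  "spowser c e = (\<lambda>m. \<Sum>j. c j * spower e j m)"

text \<open>Exponential: split \<open>f\<close> into its purely infinite part, its constant term and its infinitesimal part.\<close>

definition sexp :: "series \<Rightarrow> series" where
  "sexp f =
     sconst (exp (f mone))
     \<otimes> mon (mexp (\<lambda>m. if mone \<prec> m then f m else 0))
     \<otimes> spowser (\<lambda>j. 1 / fact j) (\<lambda>m. if m \<prec> mone then f m else 0)"

definition lead_mono :: "series \<Rightarrow> mono" where
  "lead_mono f = (THE m. m \<in> supp f \<and> (\<forall>n\<in>supp f. n = m \<or> n \<prec> m))"

text \<open>
  Logarithm, the inverse of \<^const>\<open>sexp\<close>, of a positive series \<open>f = c m (1 + e)\<close> with leading term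
  \<open>c m\<close> and infinitesimal \<open>e\<close>: \<open>log f = log m + ln c + log (1 + e)\<close>.
\<close>

definition slog :: "series \<Rightarrow> series" where
  "slog f =
     (let m = lead_mono f; c = f m; e = sconst (1 / c) \<otimes> mon (minv m) \<otimes> f \<oplus> sconst (- 1)
      in mlog m \<oplus> sconst (ln c) \<oplus> spowser (\<lambda>j. if j = 0 then 0 else (- 1) ^ (j + 1) / real j) e)"

definition spow :: "series \<Rightarrow> series \<Rightarrow> series" where
  "spow u v = sexp (v \<otimes> slog u)"


section \<open>Interpretation of Skolem germs\<close>

text \<open>
  The graph of the interpretation map. That two expressions for the same germ have the same value is
  the (nontrivial) statement that this relation is single-valued; it holds because the LE-series
  are an elementary extension of the real exponential field.
\<close>

inductive interp :: "germ \<Rightarrow> series \<Rightarrow> bool" where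
  one: "interp germ_one (sconst 1)"
| id: "interp germ_id sX"
| add: "interp f s \<Longrightarrow> interp g t \<Longrightarrow> interp (germ_add f g) (s \<oplus> t)"
| mult: "interp f s \<Longrightarrow> interp g t \<Longrightarrow> interp (germ_mult f g) (s \<otimes> t)"
| pow: "interp f s \<Longrightarrow> interp g t \<Longrightarrow> interp (germ_pow f g) (spow s t)"


section \<open>The field \<open>K\<close>\<close>

text \<open>The elements of \<open>G\<^sub>n\<close> are monomials; they are identified with series through \<^const>\<open>mon\<close>.\<close>

primrec G :: "nat \<Rightarrow> mono set" where
  "G 0 = {m. \<exists>k::int. mon m = spow sX (sconst (of_int k))}"
| "G (Suc n) = {m. \<exists>\<gamma> \<in> pure_inf (Hahn (G n)). \<exists>\<theta> \<in> pure_inf (Hahn (G n)). \<exists>k::int.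
                 mon m = sexp \<gamma> \<otimes> spow sX (\<theta> \<oplus> sconst (of_int k))}"

definition K :: "series set" where
  "K = (\<Union>n. Hahn (G n))"

end

theory Submission
  imports Defs "HOL-Computational_Algebra.Formal_Power_Series" "HOL-Library.Set_Algebras" "HOL-Library.Multiset"
begin

text \<open>
  The proof is an induction over the construction of Skolem functions. The induction also carries
  along that the leading coefficient is positive. Since \<open>G\<^sub>n\<close> is a group, \<open>K\<^sub>n\<close> is a ring, and
  \<open>K\<^sub>n\<up> + \<nat>\<close> is closed under addition and multiplication. The point is closure under powers \<open>u\<^sup>v\<close>. Write
  \<open>u = c m (1 + e)\<close> with leading term \<open>c m\<close> and infinitesimal \<open>e\<close>, so that
  \<open>v log u = v (log m + log c + log (1 + e))\<close>.

  \<^item> If \<open>u\<close> is a natural number, the exponent is \<open>v log u\<close> with a real number \<open>log u \<ge> 0\<close>, and the power is a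
  natural number times the exponential of a purely infinite series (\<open>skolem_form_const_power\<close>).

  \<^item> If \<open>v\<close> is a natural number, the power is an iterated product. This rests on
  \<open>exp (v log (1 + e)) = (1 + e)\<^sup>v\<close> for formal power series evaluated at \<open>e\<close> (\<open>spow_nat\<close>).

  \<^item> If both are infinite, the infinitesimal part of \<open>v log u\<close> creates monomials below \<open>1\<close>. They are bounded
  below by powers of \<open>1 / m\<close>, as all monomials of \<open>u\<close> and \<open>v\<close> are \<open>\<ge> 1\<close>. The monomial
  \<open>exp ((v log u)\<up>)\<close> by which they are multiplied exceeds all powers of \<open>m\<close>, as \<open>v\<close> is infinite. So the
  product is purely infinite (\<open>skolem_form_infinite_power\<close>).

  To compute with series one needs a ring of Hahn series over an ordered abelian group in which power
  series can be evaluated at infinitesimal elements. This is developed for an arbitrary group;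
  the combinatorial core is Neumann's lemma (\<open>neumann_lemma\<close>), and evaluation is a ring homomorphism
  compatible with composition (\<open>peval_mult\<close>, \<open>peval_compose\<close>). The group to which it is applied is the
  group of logarithmic-exponential monomials with hereditarily countable exponents. Its elements have a
  logarithm that is inverse to \<open>mexp\<close>, and by induction on the exponential level \<open>\<prec>\<close> is a linear
  order on it (\<open>mlinear_level\<close>, \<open>mlinear_LEM\<close>). Countability is harmless, because the series that interpret
  Skolem functions arise from \<open>x\<close> by operations that preserve it.
\<close>

section \<open>Reverse-well-ordered subsets of an ordered group\<close>

definition revwo :: "'a::linorder set \<Rightarrow> bool" where
  "revwo A \<longleftrightarrow> (\<forall>B\<subseteq>A. B \<noteq> {} \<longrightarrow> (\<exists>b\<in>B. \<forall>a\<in>B. a \<le> b))"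

lemma revwo_max:
  assumes "revwo A" "B \<subseteq> A" "B \<noteq> {}"
  obtains b where "b \<in> B" "\<And>a. a \<in> B \<Longrightarrow> a \<le> b"
  using assms unfolding revwo_def by metis

lemma revwo_greatest:
  assumes "revwo A" "\<And>x. P x \<Longrightarrow> x \<in> A" "P x0"
  shows "\<exists>b. P b \<and> (\<forall>a. P a \<longrightarrow> a \<le> b)"
proof -
  have "{x. P x} \<subseteq> A" "{x. P x} \<noteq> {}" using assms by auto
  from revwo_max[OF assms(1) this] show ?thesis by auto
qed

lemma revwo_subset: "revwo A \<Longrightarrow> B \<subseteq> A \<Longrightarrow> revwo B"
  unfolding revwo_def by (meson order_trans)

lemma revwo_empty [simp]: "revwo {}"
  by (simp add: revwo_def)

lemma revwo_insert:
  assumes "revwo A" shows "revwo (insert x A)"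
  unfolding revwo_def
proof (intro allI impI)
  fix B assume B: "B \<subseteq> insert x A" "B \<noteq> {}"
  show "\<exists>b\<in>B. \<forall>a\<in>B. a \<le> b"
  proof (cases "B \<subseteq> {x}")
    case True
    then show ?thesis using B by auto
  next
    case False
    then obtain b where b: "b \<in> B - {x}" "\<And>a. a \<in> B - {x} \<Longrightarrow> a \<le> b"
      using B revwo_max[OF assms, of "B - {x}"] by (metis Diff_subset_conv Diff_eq_empty_iff insert_is_Un)
    show ?thesis
    proof (cases "x \<in> B \<and> b \<le> x")
      case True
      then show ?thesis using b(2) by (intro bexI[of _ x]) force+
    next
      case False
      then show ?thesis using b by (intro bexI[of _ b]) force+
    qed
  qed
qed

lemma revwo_Un:
  assumes "revwo A" "revwo B" shows "revwo (A \<union> B)"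
  unfolding revwo_def
proof (intro allI impI)
  fix C assume C: "C \<subseteq> A \<union> B" "C \<noteq> {}"
  have max: "(C \<inter> D = {}) \<or> (\<exists>b\<in>C \<inter> D. \<forall>a\<in>C \<inter> D. a \<le> b)" if "revwo D" for D
    using that unfolding revwo_def by (metis inf_le2)
  show "\<exists>b\<in>C. \<forall>a\<in>C. a \<le> b"
  proof (cases "C \<inter> A = {} \<or> C \<inter> B = {}")
    case True
    then show ?thesis using max[OF assms(1)] max[OF assms(2)] C by blast
  next
    case False
    then obtain a b where a: "a \<in> C \<inter> A" "\<forall>x\<in>C \<inter> A. x \<le> a" and b: "b \<in> C \<inter> B" "\<forall>x\<in>C \<inter> B. x \<le> b"
      using max[OF assms(1)] max[OF assms(2)] by blast
    show ?thesis
    proof (rule bexI[of _ "max a b"], rule ballI)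
      fix x assume "x \<in> C"
      then have "x \<le> a \<or> x \<le> b" using a b C(1) by auto
      then show "x \<le> max a b" by (simp add: le_max_iff_disj)
    qed (use a b in \<open>auto simp: max_def\<close>)
  qed
qed

lemma revwo_UN: "finite I \<Longrightarrow> (\<And>i. i \<in> I \<Longrightarrow> revwo (A i)) \<Longrightarrow> revwo (\<Union>i\<in>I. A i)"
  by (induction I rule: finite_induct) (auto intro: revwo_Un)

text \<open>
  Consider the points of \<open>A\<close> with only finitely many elements of \<open>A\<close> above them. The least of them
  is the minimum of \<open>A\<close>: otherwise the greatest element below it would be another such point. So
  all of \<open>A\<close> lies above a point with finitely many elements above it.
\<close>

lemma finite_if_bi_well_ordered:
  assumes max: "revwo A" and min: "\<And>B. B \<subseteq> A \<Longrightarrow> B \<noteq> {} \<Longrightarrow> \<exists>b\<in>B. \<forall>a\<in>B. b \<le> a"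
  shows "finite A"
proof (cases "A = {}")
  case False
  define U where "U = {a\<in>A. finite {x\<in>A. a \<le> x}}"
  obtain t where t: "t \<in> A" "\<And>a. a \<in> A \<Longrightarrow> a \<le> t"
    using revwo_max[OF max order_refl False] by metis
  have "{x\<in>A. t \<le> x} = {t}" using t by (auto intro: antisym)
  then have "t \<in> U" using t by (simp add: U_def)
  then obtain u where u: "u \<in> U" "\<forall>a\<in>U. u \<le> a" using min[of U] by (auto simp: U_def)
  have "{x\<in>A. x < u} = {}"
  proof (rule ccontr)
    assume "{x\<in>A. x < u} \<noteq> {}"
    then obtain v where v: "v \<in> {x\<in>A. x < u}" "\<And>a. a \<in> {x\<in>A. x < u} \<Longrightarrow> a \<le> v"
      using revwo_max[OF max, of "{x\<in>A. x < u}"] by (metis (no_types, lifting) mem_Collect_eq subsetI)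
    have "{x\<in>A. v \<le> x} \<subseteq> insert v {x\<in>A. u \<le> x}"
      using v(2) by (force simp: not_le)
    then have "v \<in> U" using u(1) v(1) unfolding U_def by (auto dest: finite_subset)
    then show False using u(2) v(1) by auto
  qed
  then have "A = {x\<in>A. u \<le> x}" by auto
  then show ?thesis using u(1) by (simp add: U_def)
qed simp

lemma finite_fiber:
  fixes A B :: "'a::linordered_ab_group_add set"
  assumes "revwo A" "revwo B"
  shows "finite {a\<in>A. q - a \<in> B}"
proof (rule finite_if_bi_well_ordered)
  show "revwo {a\<in>A. q - a \<in> B}" using assms(1) by (rule revwo_subset) auto
next
  fix C assume C: "C \<subseteq> {a\<in>A. q - a \<in> B}" "C \<noteq> {}"
  then have "(\<lambda>a. q - a) ` C \<subseteq> B" "(\<lambda>a. q - a) ` C \<noteq> {}" by auto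
  from revwo_max[OF assms(2) this] obtain b where
    "b \<in> (\<lambda>a. q - a) ` C" "\<And>x. x \<in> (\<lambda>a. q - a) ` C \<Longrightarrow> x \<le> b" by metis
  then show "\<exists>b\<in>C. \<forall>a\<in>C. b \<le> a" by fastforce
qed

text \<open>
  Suppose that \<open>C \<subseteq> A + B\<close> has no greatest element. Among the pairs \<open>(a, b)\<close> whose sum exceeds all sums
  in \<open>C\<close> with a larger first summand take one with \<open>b\<close> greatest. The pair of some larger sum,
  with the first summand and then the second one as large as possible, has the same property and
  a larger \<open>b\<close>.
\<close>

lemma revwo_set_plus:
  fixes A B :: "'a::linordered_ab_group_add set"
  assumes A: "revwo A" and B: "revwo B"
  shows "revwo (A + B)"
  unfolding revwo_def
proof (intro allI impI, rule ccontr)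
  fix C assume C: "C \<subseteq> A + B" "C \<noteq> {}" and "\<not> (\<exists>b\<in>C. \<forall>a\<in>C. a \<le> b)"
  then have nomax: "\<exists>d\<in>C. c < d" if "c \<in> C" for c using that by (meson not_le)
  define P where "P a b \<longleftrightarrow> a \<in> A \<and> b \<in> B \<and> a + b \<in> C" for a b
  define rec where "rec a b \<longleftrightarrow> P a b \<and> (\<forall>a' b'. P a' b' \<longrightarrow> a < a' \<longrightarrow> a' + b' < a + b)" for a b
  have best: "\<exists>a b. P a b \<and> Q (a + b) \<and> (\<forall>a' b'. P a' b' \<longrightarrow> Q (a' + b') \<longrightarrow> a' < a \<or> a' = a \<and> b' \<le> b)"
    if ex: "\<exists>c\<in>C. Q c" for Q
  proof -
    obtain c where c: "c \<in> C" "Q c" using ex by blast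
    then obtain a0 b0 where "a0 \<in> A" "b0 \<in> B" "c = a0 + b0"
      using C(1) by (blast elim: set_plus_elim)
    with c have 0: "\<exists>b. P a0 b \<and> Q (a0 + b)" by (auto simp: P_def)
    have "\<exists>a. (\<exists>b. P a b \<and> Q (a + b)) \<and> (\<forall>a'. (\<exists>b. P a' b \<and> Q (a' + b)) \<longrightarrow> a' \<le> a)"
      by (rule revwo_greatest[OF A, of _ a0]; use 0 in \<open>auto simp: P_def\<close>)
    then obtain a b1 where a: "P a b1 \<and> Q (a + b1)" "\<And>a' b. P a' b \<Longrightarrow> Q (a' + b) \<Longrightarrow> a' \<le> a"
      by blast
    have "\<exists>b. (P a b \<and> Q (a + b)) \<and> (\<forall>b'. P a b' \<and> Q (a + b') \<longrightarrow> b' \<le> b)"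
      by (rule revwo_greatest[OF B, of _ b1]; use a(1) in \<open>auto simp: P_def\<close>)
    then obtain b
      where "P a b" "Q (a + b)" "\<And>b'. P a b' \<Longrightarrow> Q (a + b') \<Longrightarrow> b' \<le> b"
      by blast
    then show ?thesis using a(2) by (metis order_le_less)
  qed
  obtain a0 b0 where "P a0 b0" "\<forall>a' b'. P a' b' \<longrightarrow> a' < a0 \<or> a' = a0 \<and> b' \<le> b0"
    using best[of "\<lambda>_. True"] C(2) by auto
  then have 0: "\<exists>a. rec a b0" unfolding rec_def by (metis order_less_asym order_less_irrefl)
  have "\<exists>b. (\<exists>a. rec a b) \<and> (\<forall>b'. (\<exists>a. rec a b') \<longrightarrow> b' \<le> b)"
    by (rule revwo_greatest[OF B, of _ b0]; use 0 in \<open>auto simp: rec_def P_def\<close>)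
  then obtain a b
    where ab: "rec a b" and bmax: "\<And>a' b'. rec a' b' \<Longrightarrow> b' \<le> b"
    by blast
  then have "\<exists>c\<in>C. a + b < c" using nomax by (simp add: rec_def P_def)
  from best[of "\<lambda>c. a + b < c", OF this] obtain a' b' where 1: "P a' b'" "a + b < a' + b'"
    and 2: "\<And>a'' b''. P a'' b'' \<Longrightarrow> a + b < a'' + b'' \<Longrightarrow> a'' < a' \<or> a'' = a' \<and> b'' \<le> b'" by blast
  have "rec a' b'" unfolding rec_def
    using 1 2 by (metis dual_order.strict_trans not_less_iff_gr_or_eq not_le order_le_less)
  moreover have "a' \<le> a" using ab 1 unfolding rec_def by (meson not_le order_less_asym)
  ultimately show False using bmax[of a' b'] 1(2) add_mono[of a' a b' b] by simp
qed

section \<open>Neumann's lemma\<close>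

text \<open>
  Multisets suffice to record the summands, since the group is commutative. Here \<open>fold_sums A j\<close>
  contains the supports of \<open>j\<close>-th powers of series supported in \<open>A\<close>, and \<open>span_sums A\<close> those of
  all power series in them.
\<close>

definition fold_sums :: "'a::comm_monoid_add set \<Rightarrow> nat \<Rightarrow> 'a set" where
  "fold_sums A j = {sum_mset M | M. set_mset M \<subseteq> A \<and> size M = j}"

definition span_sums :: "'a::comm_monoid_add set \<Rightarrow> 'a set" where
  "span_sums A = {sum_mset M | M. set_mset M \<subseteq> A}"

lemma span_sums_eq: "span_sums A = (\<Union>j. fold_sums A j)"
  by (auto simp: span_sums_def fold_sums_def)

lemma fold_sums_0 [simp]: "fold_sums A 0 = {0}"
  by (auto simp: fold_sums_def)

lemma fold_sums_Suc: "fold_sums A (Suc j) = A + fold_sums A j"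
proof (intro equalityI subsetI)
  fix q assume "q \<in> fold_sums A (Suc j)"
  then obtain M where M: "q = sum_mset M" "set_mset M \<subseteq> A" "size M = Suc j"
    by (auto simp: fold_sums_def)
  obtain a N where "M = add_mset a N" using size_eq_Suc_imp_eq_union[OF M(3)] by auto
  then show "q \<in> A + fold_sums A j"
    using M by (auto simp: fold_sums_def intro!: set_plus_intro)
next
  fix q assume "q \<in> A + fold_sums A j"
  then obtain a N where "q = a + sum_mset N" "a \<in> A" "set_mset N \<subseteq> A" "size N = j"
    by (auto simp: fold_sums_def elim!: set_plus_elim)
  then show "q \<in> fold_sums A (Suc j)"
    unfolding fold_sums_def by (intro CollectI exI[of _ "add_mset a N"]) auto
qed

lemma revwo_fold_sums:
  fixes A :: "'a::linordered_ab_group_add set"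
  shows "revwo A \<Longrightarrow> revwo (fold_sums A j)"
  by (induction j) (auto simp: fold_sums_Suc intro: revwo_set_plus revwo_insert)

lemma span_sums_subset:
  assumes "\<And>a. a \<in> A \<Longrightarrow> P a" "P 0" "\<And>a b. P a \<Longrightarrow> P b \<Longrightarrow> P (a + b)" "q \<in> span_sums A"
  shows "P q"
proof -
  have "set_mset M \<subseteq> A \<Longrightarrow> P (sum_mset M)" for M
    by (induction M) (auto intro: assms)
  then show ?thesis using assms(4) by (auto simp: span_sums_def)
qed

lemma countable_span_sums:
  assumes "countable A" shows "countable (span_sums A)"
proof -
  have "countable (fold_sums A j)" for j
  proof (induction j)
    case (Suc j)
    have "A + fold_sums A j = (\<lambda>(a, b). a + b) ` (A \<times> fold_sums A j)"
      by (auto simp: set_plus_def)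
    then show ?case using Suc assms by (simp add: fold_sums_Suc)
  qed simp
  then show ?thesis by (simp add: span_sums_eq)
qed

lemma sum_mset_replicate_antimono:
  fixes a :: "'a::linordered_ab_group_add"
  assumes "a \<le> 0" "n \<le> m"
  shows "sum_mset (replicate_mset m a) \<le> sum_mset (replicate_mset n a)"
  using assms(2)
proof (induction rule: dec_induct)
  case (step k)
  then show ?case using assms(1) add_mono[of a 0] by simp
qed simp

lemma sum_mset_le_replicate:
  fixes a :: "'a::linordered_ab_group_add"
  shows "(\<And>x. x \<in># M \<Longrightarrow> x \<le> a) \<Longrightarrow> sum_mset M \<le> sum_mset (replicate_mset (size M) a)"
  by (induction M) (auto intro: add_mono)

lemma sum_mset_ge_replicate:
  fixes a :: "'a::linordered_ab_group_add"
  shows "(\<And>x. x \<in># M \<Longrightarrow> a \<le> x) \<Longrightarrow> sum_mset (replicate_mset (size M) a) \<le> sum_mset M"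
  by (induction M) (auto intro: add_mono)

lemma sum_mset_nonpos:
  fixes M :: "'a::linordered_ab_group_add multiset"
  shows "(\<And>x. x \<in># M \<Longrightarrow> x \<le> 0) \<Longrightarrow> sum_mset M \<le> 0"
  by (induction M) (auto intro: add_nonpos_nonpos)

text \<open>
  The two facts that make a power series in a series with support \<open>A\<close> meaningful: the result has an
  admissible support, and each of its coefficients receives contributions from finitely many powers.
\<close>

definition neumann :: "'a::linordered_ab_group_add set \<Rightarrow> bool" where
  "neumann A \<longleftrightarrow> revwo (span_sums A) \<and> (\<forall>q. finite {j. q \<in> fold_sums A j})"

text \<open>
  A sum \<open>\<ge> c\<close> of negative elements has only boundedly many summands \<open>\<le> a\<close>, as soon as some
  multiple of \<open>a\<close> is below \<open>c\<close>. If \<open>c\<close> is itself a sum of elements of \<open>A \<noteq> {}\<close>, such \<open>a \<in> A\<close> exist, and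
  for the greatest of them the sums \<open>\<ge> c\<close> arise from the sums over the upper segment
  \<open>{x \<in> A. a < x}\<close> by adding elements of finitely many fold sums of \<open>A\<close>. Thus Neumann's property
  passes from the proper upper segments of \<open>A\<close> to \<open>A\<close>.
\<close>

lemma neumann_step:
  fixes A :: "'a::linordered_ab_group_add set"
  assumes A: "revwo A" and neg: "\<And>a. a \<in> A \<Longrightarrow> a < 0"
    and IH: "\<And>a. a \<in> A \<Longrightarrow> neumann {x\<in>A. a < x}"
  shows "neumann A"
proof -
  \<comment> \<open>\<open>A1\<close> is the upper segment, \<open>D\<close> the union of the fold sums, \<open>n\<close> the bound on the number of summands.\<close>
  have split: "\<exists>A1 D n. neumann A1 \<and> revwo D \<and>
      (\<forall>j. \<forall>q\<in>fold_sums A j. c \<le> q \<longrightarrow>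
         (\<exists>b\<in>D. \<exists>i<n. \<exists>k. j = k + i \<and> q - b \<in> fold_sums A1 k))"
    if c: "c \<in> span_sums A" for c
  proof (cases "A = {}")
    case True
    have "neumann ({} :: 'a set)"
      by (auto simp: neumann_def span_sums_def fold_sums_def intro: revwo_insert)
    moreover have "\<exists>b\<in>{0}. \<exists>i<Suc 0. \<exists>k. j = k + i \<and> q - b \<in> fold_sums {} k" if "q \<in> fold_sums A j" for j q
      using that True by auto
    ultimately show ?thesis using revwo_insert[OF revwo_empty] by blast
  next
    case False
    obtain M0 where M0: "c = sum_mset M0" "set_mset M0 \<subseteq> A" using c by (auto simp: span_sums_def)
    define A2 where "A2 = {a\<in>A. \<exists>n. sum_mset (replicate_mset n a) < c}"
    have "A2 \<noteq> {}"
    proof -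
      obtain a where a: "a \<in> A" "\<And>x. x \<in># M0 \<Longrightarrow> a \<le> x"
      proof (cases "M0 = {#}")
        case True
        then show ?thesis using False that by auto
      next
        case False
        then show ?thesis using M0(2) that[of "Min (set_mset M0)"]
          by (metis Min_in Min_le finite_set_mset set_mset_eq_empty_iff subsetD)
      qed
      have "sum_mset (replicate_mset (Suc (size M0)) a) < sum_mset (replicate_mset (size M0) a)"
        using neg[OF a(1)] by simp
      also have "\<dots> \<le> c" unfolding M0 by (rule sum_mset_ge_replicate) (rule a)
      finally have "a \<in> A2" unfolding A2_def using a(1) by blast
      then show ?thesis by auto
    qed
    then obtain a where a: "a \<in> A2" "\<And>x. x \<in> A2 \<Longrightarrow> x \<le> a"
      using revwo_greatest[OF A, of "\<lambda>x. x \<in> A2"] unfolding A2_def by blast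
    then have "a \<in> A" by (simp add: A2_def)
    obtain n where n: "sum_mset (replicate_mset n a) < c" using a by (auto simp: A2_def)
    define A1 where "A1 = {x\<in>A. a < x}"
    define D where "D = (\<Union>i<n. fold_sums {x\<in>A. x \<le> a} i)"
    have "neumann A1" unfolding A1_def using IH \<open>a \<in> A\<close> .
    moreover have "revwo D" unfolding D_def
      by (intro revwo_UN revwo_fold_sums revwo_subset[OF A]) auto
    moreover have "\<exists>b\<in>D. \<exists>i<n. \<exists>k. j = k + i \<and> q - b \<in> fold_sums A1 k"
      if q: "q \<in> fold_sums A j" "c \<le> q" for j q
    proof -
      obtain M where M: "q = sum_mset M" "set_mset M \<subseteq> A" "size M = j"
        using q by (auto simp: fold_sums_def)
      define M1 M2 where "M1 = filter_mset (\<lambda>x. \<not> x \<le> a) M" and "M2 = filter_mset (\<lambda>x. x \<le> a) M"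
      have MM: "M = M2 + M1" unfolding M1_def M2_def by (rule multiset_partition)
      have "size M2 < n"
      proof (rule ccontr)
        assume "\<not> size M2 < n"
        have "q \<le> sum_mset M2"
          unfolding M MM using sum_mset_nonpos[of M1] M(2) neg
          by (force simp: M1_def add_decreasing2)
        also have "\<dots> \<le> sum_mset (replicate_mset (size M2) a)"
          by (rule sum_mset_le_replicate) (simp add: M2_def)
        also have "\<dots> \<le> sum_mset (replicate_mset n a)"
          using neg[OF \<open>a \<in> A\<close>] \<open>\<not> size M2 < n\<close> by (intro sum_mset_replicate_antimono) auto
        finally show False using n q(2) by simp
      qed
      moreover have "sum_mset M2 \<in> D"
        unfolding D_def fold_sums_def using \<open>size M2 < n\<close> M(2)
        by (intro UN_I[of "size M2"] CollectI exI[of _ M2]) (auto simp: M2_def)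
      moreover have "q - sum_mset M2 \<in> fold_sums A1 (size M1)"
        unfolding fold_sums_def M(1) using M(2)
        by (intro CollectI exI[of _ M1]) (auto simp: MM[symmetric] M1_def A1_def arg_cong[OF MM, of sum_mset])
      moreover have "j = size M1 + size M2" using M(3) MM by simp
      ultimately show ?thesis by blast
    qed
    ultimately show ?thesis by blast
  qed
  have "revwo (span_sums A)" unfolding revwo_def
  proof (intro allI impI)
    fix B assume B: "B \<subseteq> span_sums A" "B \<noteq> {}"
    then obtain c where c: "c \<in> B" by auto
    obtain A1 D n where A1: "neumann A1" and D: "revwo D" and sp: "\<And>j q. q \<in> fold_sums A j \<Longrightarrow> c \<le> q \<Longrightarrow>
         (\<exists>b\<in>D. \<exists>i<n. \<exists>k. j = k + i \<and> q - b \<in> fold_sums A1 k)"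
      using split[OF subsetD[OF B(1) c]] by blast
    have "{b\<in>B. c \<le> b} \<subseteq> D + span_sums A1"
    proof
      fix q assume "q \<in> {b\<in>B. c \<le> b}"
      moreover then obtain j where "q \<in> fold_sums A j" using B(1) by (auto simp: span_sums_eq)
      ultimately obtain b k where "b \<in> D" "q - b \<in> fold_sums A1 k" using sp by blast
      then show "q \<in> D + span_sums A1"
        using set_plus_intro[of b D "q - b" "span_sums A1"] by (auto simp: span_sums_eq)
    qed
    moreover have "revwo (D + span_sums A1)"
      using A1 D by (intro revwo_set_plus) (auto simp: neumann_def)
    moreover have "{b\<in>B. c \<le> b} \<noteq> {}" using c by auto
    ultimately obtain b where "b \<in> {b\<in>B. c \<le> b}" "\<And>a. a \<in> {b\<in>B. c \<le> b} \<Longrightarrow> a \<le> b"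
      by (meson revwo_max)
    then show "\<exists>b\<in>B. \<forall>a\<in>B. a \<le> b"
      by (intro bexI[of _ b]) (auto, meson linear order_trans)
  qed
  moreover have "finite {j. q \<in> fold_sums A j}" for q
  proof (cases "q \<in> span_sums A")
    case True
    then obtain A1 D n where A1: "neumann A1" and D: "revwo D" and sp: "\<And>j. q \<in> fold_sums A j \<Longrightarrow>
         (\<exists>b\<in>D. \<exists>i<n. \<exists>k. j = k + i \<and> q - b \<in> fold_sums A1 k)"
      using split[OF True] by blast
    have "{j. q \<in> fold_sums A j} \<subseteq>
        (\<Union>b\<in>{b\<in>D. q - b \<in> span_sums A1}. \<Union>i<n. (\<lambda>k. k + i) ` {k. q - b \<in> fold_sums A1 k})"
      using sp by (fastforce simp: span_sums_eq)
    moreover have "finite {b\<in>D. q - b \<in> span_sums A1}"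
      using A1 D by (intro finite_fiber) (auto simp: neumann_def)
    ultimately show ?thesis using A1 by (auto simp: neumann_def elim!: finite_subset)
  qed (simp add: span_sums_eq)
  ultimately show ?thesis by (simp add: neumann_def)
qed

text \<open>
  By the previous step it suffices to treat the upper segments of \<open>A\<close>. If one of them failed, the
  one that is cut off at the greatest possible point would contradict the previous step.
\<close>

lemma neumann_lemma:
  fixes A :: "'a::linordered_ab_group_add set"
  assumes A: "revwo A" and neg: "\<And>a. a \<in> A \<Longrightarrow> a < 0"
  shows "neumann A"
proof (rule neumann_step[OF A neg], assumption, rule ccontr)
  fix a assume a: "a \<in> A" "\<not> neumann {x\<in>A. a < x}"
  define B where "B = {a\<in>A. \<not> neumann {x\<in>A. a < x}}"
  have "\<exists>b. b \<in> B \<and> (\<forall>a. a \<in> B \<longrightarrow> a \<le> b)"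
  proof (rule revwo_greatest[OF A])
    show "a \<in> B" using a by (simp add: B_def)
  qed (simp add: B_def)
  then obtain b where b: "b \<in> B" "\<And>a. a \<in> B \<Longrightarrow> a \<le> b" by blast
  have "neumann {x\<in>A. b < x}"
  proof (rule neumann_step)
    show "revwo {x\<in>A. b < x}" using A by (rule revwo_subset) auto
    fix c assume c: "c \<in> {x\<in>A. b < x}"
    then show "c < 0" using neg by auto
    have "c \<notin> B" using b(2)[of c] c by auto
    then have "neumann {x\<in>A. c < x}" using c by (simp add: B_def)
    moreover have "{x \<in> {x\<in>A. b < x}. c < x} = {x\<in>A. c < x}" using c by auto
    ultimately show "neumann {x \<in> {x\<in>A. b < x}. c < x}" by simp
  qed
  then show False using b(1) by (simp add: B_def)
qed

section \<open>The ring of Hahn series\<close>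

text \<open>
  Monomials form an additively written group, so that \<open>0\<close> stands for the monomial \<open>1\<close>. Only series
  with countable support are considered, because the logarithm of a monomial is recorded as a countable
  graph. Sums, products and power series stay within countable supports.
\<close>

typedef (overloaded) 'a hahn =
  "{f :: 'a::linordered_ab_group_add \<Rightarrow> real. countable {a. f a \<noteq> 0} \<and> revwo {a. f a \<noteq> 0}}"
  morphisms hcoeff Abs_hahn
  by (rule exI[of _ "\<lambda>_. 0"]) simp

setup_lifting type_definition_hahn

definition hsupp :: "'a::linordered_ab_group_add hahn \<Rightarrow> 'a set" where
  "hsupp f = {a. hcoeff f a \<noteq> 0}"

lemma in_hsupp: "a \<in> hsupp f \<longleftrightarrow> hcoeff f a \<noteq> 0"
  by (simp add: hsupp_def)

lemma countable_hsupp: "countable (hsupp f)" and revwo_hsupp: "revwo (hsupp f)"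
  using hcoeff[of f] by (simp_all add: hsupp_def)

lemma hahn_eqI: "(\<And>a. hcoeff f a = hcoeff g a) \<Longrightarrow> f = g"
  by (simp add: hcoeff_inject[symmetric] fun_eq_iff)

text \<open>
  For series with reverse-well-ordered supports the index set is finite, by \<open>finite_fiber\<close>, so that the
  sum is the coefficient of the product; otherwise it may have the default value \<open>0\<close>.
\<close>

definition convolution :: "('a::linordered_ab_group_add \<Rightarrow> real) \<Rightarrow> ('a \<Rightarrow> real) \<Rightarrow> 'a \<Rightarrow> real" where
  "convolution f g m = (\<Sum>a\<in>{a. f a \<noteq> 0 \<and> g (m - a) \<noteq> 0}. f a * g (m - a))"

lemma convolution_supp: "{m. convolution f g m \<noteq> 0} \<subseteq> {a. f a \<noteq> 0} + {a. g a \<noteq> 0}"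
proof
  fix m assume "m \<in> {m. convolution f g m \<noteq> 0}"
  then have "(\<Sum>a\<in>{a. f a \<noteq> 0 \<and> g (m - a) \<noteq> 0}. f a * g (m - a)) \<noteq> 0"
    by (simp add: convolution_def)
  then obtain a where "a \<in> {a. f a \<noteq> 0 \<and> g (m - a) \<noteq> 0}"
    by (rule sum.not_neutral_contains_not_neutral)
  then show "m \<in> {a. f a \<noteq> 0} + {a. g a \<noteq> 0}"
    using set_plus_intro[of a "{a. f a \<noteq> 0}" "m - a" "{a. g a \<noteq> 0}"] by simp
qed

lemma countable_set_plus: "countable A \<Longrightarrow> countable B \<Longrightarrow> countable (A + B)"
  by (simp add: set_plus_image)

instantiation hahn :: (linordered_ab_group_add) "{zero, one, plus, minus, uminus, times}"
begin

lift_definition zero_hahn :: "'a hahn" is "\<lambda>_. 0" by simp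

lift_definition one_hahn :: "'a hahn" is "\<lambda>a. if a = 0 then 1 else 0"
  by (simp add: revwo_insert)

lift_definition plus_hahn :: "'a hahn \<Rightarrow> 'a hahn \<Rightarrow> 'a hahn" is "\<lambda>f g a. f a + g a"
proof -
  fix f g :: "'a \<Rightarrow> real"
  assume *: "countable {a. f a \<noteq> 0} \<and> revwo {a. f a \<noteq> 0}" "countable {a. g a \<noteq> 0} \<and> revwo {a. g a \<noteq> 0}"
  have "{a. f a + g a \<noteq> 0} \<subseteq> {a. f a \<noteq> 0} \<union> {a. g a \<noteq> 0}" by auto
  with * show "countable {a. f a + g a \<noteq> 0} \<and> revwo {a. f a + g a \<noteq> 0}"
    by (meson countable_Un countable_subset revwo_Un revwo_subset)
qed

lift_definition uminus_hahn :: "'a hahn \<Rightarrow> 'a hahn" is "\<lambda>f a. - f a" by simp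

definition minus_hahn :: "'a hahn \<Rightarrow> 'a hahn \<Rightarrow> 'a hahn" where
  "minus_hahn f g = f + - g"

lift_definition times_hahn :: "'a hahn \<Rightarrow> 'a hahn \<Rightarrow> 'a hahn" is convolution
proof -
  fix f g :: "'a \<Rightarrow> real"
  assume "countable {a. f a \<noteq> 0} \<and> revwo {a. f a \<noteq> 0}" "countable {a. g a \<noteq> 0} \<and> revwo {a. g a \<noteq> 0}"
  then show "countable {a. convolution f g a \<noteq> 0} \<and> revwo {a. convolution f g a \<noteq> 0}"
    using convolution_supp[of f g] countable_set_plus revwo_set_plus
    by (metis (no_types, lifting) countable_subset revwo_subset)
qed

instance ..

end

lemma hcoeff_zero [simp]: "hcoeff 0 a = 0"
  by transfer simp

lemma hcoeff_one: "hcoeff 1 a = (if a = 0 then 1 else 0)"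
  by transfer simp

lemma hcoeff_add [simp]: "hcoeff (f + g) a = hcoeff f a + hcoeff g a"
  by transfer simp

lemma hcoeff_uminus [simp]: "hcoeff (- f) a = - hcoeff f a"
  by transfer simp

lemma hcoeff_minus [simp]: "hcoeff (f - g) a = hcoeff f a - hcoeff g a"
  by (simp add: minus_hahn_def)

lemma finite_mult_fiber: "finite {a. hcoeff f a \<noteq> 0 \<and> hcoeff g (m - a) \<noteq> 0}"
  using finite_fiber[OF revwo_hsupp[of f] revwo_hsupp[of g], of m] by (simp add: hsupp_def)

lemma hcoeff_mult: "hcoeff (f * g) m = (\<Sum>a\<in>{a. hcoeff f a \<noteq> 0 \<and> hcoeff g (m - a) \<noteq> 0}. hcoeff f a * hcoeff g (m - a))"
  by transfer (simp add: convolution_def)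

lemma hcoeff_mult_sum:
  assumes "finite A" "\<And>a. hcoeff f a \<noteq> 0 \<Longrightarrow> hcoeff g (m - a) \<noteq> 0 \<Longrightarrow> a \<in> A"
  shows "hcoeff (f * g) m = (\<Sum>a\<in>A. hcoeff f a * hcoeff g (m - a))"
  unfolding hcoeff_mult by (rule sum.mono_neutral_left) (use assms in auto)

lemma hsupp_mult: "hsupp (f * g) \<subseteq> hsupp f + hsupp g"
  unfolding hsupp_def by transfer (rule convolution_supp)

lemma hahn_mult_commute: "f * g = g * (f :: 'a::linordered_ab_group_add hahn)"
proof (rule hahn_eqI)
  fix m
  show "hcoeff (f * g) m = hcoeff (g * f) m"
    unfolding hcoeff_mult
    by (rule sum.reindex_bij_witness[of _ "\<lambda>a. m - a" "\<lambda>a. m - a"]) auto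
qed

text \<open>
  Both sides are the sum of \<open>f a * g b * h c\<close> over \<open>a + b + c = m\<close>, a finite sum by applying
  \<open>finite_fiber\<close> twice.
\<close>

lemma hahn_mult_assoc: "(f * g) * h = f * (g * (h :: 'a::linordered_ab_group_add hahn))"
proof (rule hahn_eqI)
  fix m
  \<comment> \<open>\<open>B\<close> collects the relevant values of \<open>a + b\<close>, and \<open>X\<close> below those of \<open>a\<close>.\<close>
  define B where "B = {b\<in>hsupp f + hsupp g. m - b \<in> hsupp h}"
  have "finite B" unfolding B_def by (intro finite_fiber revwo_set_plus revwo_hsupp)
  define X where "X = (\<Union>b\<in>B. {a. hcoeff f a \<noteq> 0 \<and> hcoeff g (b - a) \<noteq> 0})"
  have "finite X" unfolding X_def using \<open>finite B\<close> finite_mult_fiber by auto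
  have inB: "a + c \<in> B" if "hcoeff f a \<noteq> 0" "hcoeff g c \<noteq> 0" "hcoeff h (m - a - c) \<noteq> 0" for a c
    using that by (auto simp: B_def in_hsupp algebra_simps)
  have inX: "a \<in> X" if "hcoeff f a \<noteq> 0" "hcoeff g c \<noteq> 0" "hcoeff h (m - a - c) \<noteq> 0" for a c
    unfolding X_def using that inB[OF that] by (intro UN_I[of "a + c"]) auto
  have "hcoeff ((f * g) * h) m = (\<Sum>b\<in>B. hcoeff (f * g) b * hcoeff h (m - b))"
    using \<open>finite B\<close> by (rule hcoeff_mult_sum) (use hsupp_mult[of f g] in \<open>auto simp: B_def hsupp_def\<close>)
  also have "\<dots> = (\<Sum>b\<in>B. \<Sum>a\<in>X. hcoeff f a * hcoeff g (b - a) * hcoeff h (m - b))"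
  proof (rule sum.cong[OF refl])
    fix b assume "b \<in> B"
    then have "hcoeff (f * g) b = (\<Sum>a\<in>X. hcoeff f a * hcoeff g (b - a))"
      using \<open>finite X\<close> by (intro hcoeff_mult_sum) (auto simp: X_def)
    then show "hcoeff (f * g) b * hcoeff h (m - b) = (\<Sum>a\<in>X. hcoeff f a * hcoeff g (b - a) * hcoeff h (m - b))"
      by (simp add: sum_distrib_right)
  qed
  also have "\<dots> = (\<Sum>a\<in>X. \<Sum>b\<in>B. hcoeff f a * hcoeff g (b - a) * hcoeff h (m - b))"
    by (rule sum.swap)
  also have "\<dots> = (\<Sum>a\<in>X. hcoeff f a * hcoeff (g * h) (m - a))"
  proof (rule sum.cong[OF refl])
    fix a assume "a \<in> X"
    then have a: "hcoeff f a \<noteq> 0" by (auto simp: X_def)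
    have "hcoeff (g * h) (m - a) = (\<Sum>c\<in>(\<lambda>b. b - a) ` B. hcoeff g c * hcoeff h (m - a - c))"
      using \<open>finite B\<close> inB[OF a]
      by (intro hcoeff_mult_sum) (auto simp: image_iff, metis add_diff_cancel_left')
    also have "\<dots> = (\<Sum>b\<in>B. hcoeff g (b - a) * hcoeff h (m - b))"
      by (subst sum.reindex) (auto simp: inj_on_def algebra_simps)
    finally show "(\<Sum>b\<in>B. hcoeff f a * hcoeff g (b - a) * hcoeff h (m - b)) = hcoeff f a * hcoeff (g * h) (m - a)"
      by (simp add: sum_distrib_left mult.assoc)
  qed
  also have "\<dots> = hcoeff (f * (g * h)) m"
  proof (rule hcoeff_mult_sum[symmetric, OF \<open>finite X\<close>])
    fix a assume a: "hcoeff f a \<noteq> 0" "hcoeff (g * h) (m - a) \<noteq> 0"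
    from a(2) obtain c where "c \<in> {c. hcoeff g c \<noteq> 0 \<and> hcoeff h (m - a - c) \<noteq> 0}"
      unfolding hcoeff_mult by (rule sum.not_neutral_contains_not_neutral)
    then show "a \<in> X" using inX a by blast
  qed
  finally show "hcoeff ((f * g) * h) m = hcoeff (f * (g * h)) m" .
qed

instance hahn :: (linordered_ab_group_add) comm_ring_1
proof
  fix f g h :: "'a hahn"
  show "f + g + h = f + (g + h)" "f + g = g + f" "0 + f = f" "- f + f = 0" "f - g = f + - g"
    by (rule hahn_eqI; simp)+
  show "f * g * h = f * (g * h)" by (rule hahn_mult_assoc)
  show "f * g = g * f" by (rule hahn_mult_commute)
  show "1 * f = f"
  proof (rule hahn_eqI)
    fix m
    have "hcoeff (1 * f) m = (\<Sum>a\<in>{0}. hcoeff 1 a * hcoeff f (m - a))"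
      by (rule hcoeff_mult_sum) (auto simp: hcoeff_one split: if_splits)
    then show "hcoeff (1 * f) m = hcoeff f m" by (simp add: hcoeff_one)
  qed
  show "(f + g) * h = f * h + g * h"
  proof (rule hahn_eqI)
    fix m
    define A where "A = {a. hcoeff f a \<noteq> 0 \<and> hcoeff h (m - a) \<noteq> 0} \<union> {a. hcoeff g a \<noteq> 0 \<and> hcoeff h (m - a) \<noteq> 0}"
    have "finite A" by (simp add: A_def finite_mult_fiber)
    then have "hcoeff (k * h) m = (\<Sum>a\<in>A. hcoeff k a * hcoeff h (m - a))" if "k \<in> {f, g, f + g}" for k
      by (rule hcoeff_mult_sum) (use that in \<open>auto simp: A_def\<close>)
    then show "hcoeff ((f + g) * h) m = hcoeff (f * h + g * h) m"
      by (simp add: sum.distrib distrib_right)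
  qed
  show "(0 :: 'a hahn) \<noteq> 1"
    by (metis hcoeff_one hcoeff_zero zero_neq_one)
qed

lift_definition hmon :: "'a::linordered_ab_group_add \<Rightarrow> 'a hahn" is "\<lambda>a b. if b = a then 1 else 0"
  by (simp add: revwo_insert)

lift_definition hconst :: "real \<Rightarrow> 'a::linordered_ab_group_add hahn" is "\<lambda>c a. if a = 0 then c else 0"
  by (auto intro: revwo_subset[OF revwo_insert[OF revwo_empty, of 0]] countable_subset[of _ "{0}"])

lemma hcoeff_hmon: "hcoeff (hmon a) b = (if b = a then 1 else 0)"
  by transfer simp

lemma hcoeff_hconst: "hcoeff (hconst c) a = (if a = 0 then c else 0)"
  by transfer simp

lemma hcoeff_hmon_mult [simp]: "hcoeff (hmon a * f) b = hcoeff f (b - a)"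
proof -
  have "hcoeff (hmon a * f) b = (\<Sum>x\<in>{a}. hcoeff (hmon a) x * hcoeff f (b - x))"
    by (rule hcoeff_mult_sum) (auto simp: hcoeff_hmon split: if_splits)
  then show ?thesis by (simp add: hcoeff_hmon)
qed

lemma hcoeff_hconst_mult [simp]: "hcoeff (hconst c * f) b = c * hcoeff f b"
proof -
  have "hcoeff (hconst c * f) b = (\<Sum>x\<in>{0}. hcoeff (hconst c) x * hcoeff f (b - x))"
    by (rule hcoeff_mult_sum) (auto simp: hcoeff_hconst split: if_splits)
  then show ?thesis by (simp add: hcoeff_hconst)
qed

lemma hmon_add: "hmon (a + b) = hmon a * hmon b"
  by (rule hahn_eqI) (auto simp: hcoeff_hmon algebra_simps)

lemma hmon_0 [simp]: "hmon 0 = 1"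
  by (rule hahn_eqI) (simp add: hcoeff_hmon hcoeff_one)

lemma hconst_0 [simp]: "hconst 0 = 0" and hconst_1 [simp]: "hconst 1 = 1"
  and hconst_add: "hconst (c + d) = hconst c + hconst d"
  and hconst_mult: "hconst (c * d) = hconst c * hconst d"
  by (rule hahn_eqI; simp add: hcoeff_hconst hcoeff_one)+

lemma hconst_of_nat: "hconst (real n) = of_nat n"
  by (induction n) (simp_all add: hconst_add)

lemma hconst_power: "hconst (c ^ n) = hconst c ^ n"
  by (induction n) (simp_all add: hconst_mult)

lemma hsupp_zero [simp]: "hsupp 0 = {}"
  by (simp add: hsupp_def)

lemma hsupp_one [simp]: "hsupp 1 = {0}"
  by (auto simp: hsupp_def hcoeff_one)

lemma hsupp_hconst: "hsupp (hconst c) \<subseteq> {0}"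
  by (auto simp: hsupp_def hcoeff_hconst)

lemma hsupp_hmon [simp]: "hsupp (hmon a) = {a}"
  by (auto simp: hsupp_def hcoeff_hmon)

lemma hsupp_add: "hsupp (f + g) \<subseteq> hsupp f \<union> hsupp g"
  by (auto simp: hsupp_def)

lemma hsupp_uminus [simp]: "hsupp (- f) = hsupp f"
  by (simp add: hsupp_def)

lemma hsupp_eq_empty [simp]: "hsupp f = {} \<longleftrightarrow> f = 0"
  by (auto simp: hsupp_def intro: hahn_eqI)

lemma hsupp_power: "hsupp (f ^ j) \<subseteq> fold_sums (hsupp f) j"
proof (induction j)
  case (Suc j)
  have "hsupp (f ^ Suc j) \<subseteq> hsupp f + hsupp (f ^ j)" using hsupp_mult[of f "f ^ j"] by simp
  also have "\<dots> \<subseteq> hsupp f + fold_sums (hsupp f) j" using Suc by (intro set_plus_mono2) auto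
  finally show ?case by (simp add: fold_sums_Suc)
qed simp

lift_definition hrestrict :: "'a set \<Rightarrow> 'a::linordered_ab_group_add hahn \<Rightarrow> 'a hahn" is
  "\<lambda>S f a. if a \<in> S then f a else 0"
  by (auto elim!: revwo_subset countable_subset[rotated])

lemma hcoeff_hrestrict [simp]: "hcoeff (hrestrict S f) a = (if a \<in> S then hcoeff f a else 0)"
  by transfer simp

lemma hsupp_hrestrict [simp]: "hsupp (hrestrict S f) = hsupp f \<inter> S"
  by (auto simp: hsupp_def)

section \<open>Power series evaluated at infinitesimal Hahn series\<close>

definition infinitesimal :: "'a::linordered_ab_group_add hahn \<Rightarrow> bool" where
  "infinitesimal e \<longleftrightarrow> (\<forall>a\<in>hsupp e. a < 0)"

text \<open>
  For infinitesimal \<open>e\<close> only finitely many powers contribute to each coefficient, and the coefficients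
  form a Hahn series, by Neumann's lemma. For other \<open>e\<close> the value is of no significance.
\<close>

definition peval :: "real fps \<Rightarrow> 'a::linordered_ab_group_add hahn \<Rightarrow> 'a hahn" where
  "peval b e = Abs_hahn (\<lambda>q. \<Sum>j\<in>{j. hcoeff (e ^ j) q \<noteq> 0}. fps_nth b j * hcoeff (e ^ j) q)"

lemma infinitesimal_neumann: "infinitesimal e \<Longrightarrow> neumann (hsupp e)"
  by (intro neumann_lemma revwo_hsupp) (simp add: infinitesimal_def)

lemma finite_power_coeffs:
  assumes "infinitesimal e" shows "finite {j. hcoeff (e ^ j) q \<noteq> 0}"
proof (rule finite_subset)
  show "{j. hcoeff (e ^ j) q \<noteq> 0} \<subseteq> {j. q \<in> fold_sums (hsupp e) j}"
    using hsupp_power[of e] by (auto simp: hsupp_def)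
  show "finite {j. q \<in> fold_sums (hsupp e) j}"
    using infinitesimal_neumann[OF assms] by (simp add: neumann_def)
qed

lemma power_coeff_bound:
  assumes "infinitesimal e" "finite Q"
  shows "\<exists>N. \<forall>q\<in>Q. \<forall>j\<ge>N. hcoeff (e ^ j) q = 0"
proof -
  have "finite (\<Union>q\<in>Q. {j. hcoeff (e ^ j) q \<noteq> 0})" using assms finite_power_coeffs by auto
  then obtain N where "\<forall>j\<in>(\<Union>q\<in>Q. {j. hcoeff (e ^ j) q \<noteq> 0}). j < N"
    by (meson finite_nat_set_iff_bounded)
  then show ?thesis by (intro exI[of _ N]) (fastforce simp: not_le)
qed

lemma peval_raw:
  assumes "infinitesimal e"
  shows "hcoeff (peval b e) q = (\<Sum>j\<in>{j. hcoeff (e ^ j) q \<noteq> 0}. fps_nth b j * hcoeff (e ^ j) q)" (is "_ = ?f q")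
    and hsupp_peval: "hsupp (peval b e) \<subseteq> span_sums (hsupp e)"
proof -
  have sub: "{q. ?f q \<noteq> 0} \<subseteq> span_sums (hsupp e)"
  proof
    fix q assume "q \<in> {q. ?f q \<noteq> 0}"
    then have "?f q \<noteq> 0" by simp
    then obtain j where "j \<in> {j. hcoeff (e ^ j) q \<noteq> 0}"
      by (rule sum.not_neutral_contains_not_neutral)
    then show "q \<in> span_sums (hsupp e)"
      using hsupp_power[of e j] by (auto simp: hsupp_def span_sums_eq)
  qed
  have "countable {q. ?f q \<noteq> 0}"
    using sub countable_span_sums[OF countable_hsupp] countable_subset by blast
  moreover have "revwo {q. ?f q \<noteq> 0}"
    using sub infinitesimal_neumann[OF assms] revwo_subset unfolding neumann_def by blast
  ultimately have eq: "hcoeff (peval b e) = ?f" unfolding peval_def by (intro Abs_hahn_inverse) simp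
  then show "hcoeff (peval b e) q = ?f q" by simp
  show "hsupp (peval b e) \<subseteq> span_sums (hsupp e)" using sub by (simp add: hsupp_def eq)
qed

lemma hcoeff_peval:
  assumes "infinitesimal e" "\<And>j. N \<le> j \<Longrightarrow> hcoeff (e ^ j) q = 0"
  shows "hcoeff (peval b e) q = (\<Sum>j<N. fps_nth b j * hcoeff (e ^ j) q)"
  unfolding peval_raw[OF assms(1)] using assms(2)
  by (intro sum.mono_neutral_left) (auto simp: not_le[symmetric])

lemma peval_0_right [simp]: "peval b 0 = hconst (fps_nth b 0)"
proof (rule hahn_eqI)
  fix q :: 'a
  have "hcoeff (peval b 0) q = (\<Sum>j<1. fps_nth b j * hcoeff (0 ^ j) q)"
    by (rule hcoeff_peval) (auto simp: infinitesimal_def power_0_left)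
  then show "hcoeff (peval b 0) q = hcoeff (hconst (fps_nth b 0)) q"
    by (simp add: hcoeff_one hcoeff_hconst)
qed

lemma peval_add:
  assumes "infinitesimal e" shows "peval (b + c) e = peval b e + peval c e"
  by (rule hahn_eqI) (simp add: peval_raw[OF assms] sum.distrib distrib_right)

lemma peval_const_mult:
  assumes "infinitesimal e" shows "peval (fps_const r * b) e = hconst r * peval b e"
  by (rule hahn_eqI) (simp add: peval_raw[OF assms] sum_distrib_left mult.assoc)

lemma peval_1 [simp]:
  assumes "infinitesimal e" shows "peval 1 e = 1"
proof (rule hahn_eqI)
  fix q
  obtain N where "\<And>j. N \<le> j \<Longrightarrow> hcoeff (e ^ j) q = 0"
    using power_coeff_bound[OF assms, of "{q}"] by auto
  then have "hcoeff (peval 1 e) q = (\<Sum>j<Suc N. fps_nth 1 j * hcoeff (e ^ j) q)"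
    by (intro hcoeff_peval[OF assms]) auto
  then show "hcoeff (peval 1 e) q = hcoeff 1 q" by (simp add: if_distrib[of "\<lambda>x. x * _"] cong: if_cong)
qed

lemma peval_X:
  assumes "infinitesimal e" shows "peval fps_X e = e"
proof (rule hahn_eqI)
  fix q
  obtain N where "\<And>j. N \<le> j \<Longrightarrow> hcoeff (e ^ j) q = 0"
    using power_coeff_bound[OF assms, of "{q}"] by auto
  then have "hcoeff (peval fps_X e) q = (\<Sum>j<Suc (Suc N). fps_nth fps_X j * hcoeff (e ^ j) q)"
    by (intro hcoeff_peval[OF assms]) auto
  also have "\<dots> = (\<Sum>j\<in>{1}. hcoeff (e ^ j) q)"
    by (intro sum.mono_neutral_cong_right) (auto simp: fps_X_def)
  finally show "hcoeff (peval fps_X e) q = hcoeff e q" by simp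
qed

text \<open>
  At a fixed monomial \<open>q\<close> only finitely many factorizations \<open>q = a + (q - a)\<close> and only powers below some
  common bound \<open>N\<close> contribute, so that the identity reduces to the Cauchy product of two finite sums.
\<close>

lemma peval_mult:
  fixes e :: "'a::linordered_ab_group_add hahn"
  assumes e: "infinitesimal e" shows "peval (b * c) e = peval b e * peval c e"
proof (rule hahn_eqI)
  fix q
  define S where "S = span_sums (hsupp e)"
  have powS: "a \<in> S" if "hcoeff (e ^ j) a \<noteq> 0" for a j
    using that hsupp_power[of e j] by (auto simp: S_def hsupp_def span_sums_eq)
  have pevS: "a \<in> S" if "hcoeff (peval d e) a \<noteq> 0" for a d
    using that hsupp_peval[OF e, of d] by (auto simp: S_def hsupp_def)
  define A where "A = {a\<in>S. q - a \<in> S}"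
  have "finite A" unfolding A_def S_def
    using infinitesimal_neumann[OF e] by (intro finite_fiber) (auto simp: neumann_def)
  then have "finite (insert q (A \<union> (\<lambda>a. q - a) ` A))" by simp
  from power_coeff_bound[OF e this] obtain N where
    N: "\<And>x j. x \<in> insert q (A \<union> (\<lambda>a. q - a) ` A) \<Longrightarrow> N \<le> j \<Longrightarrow> hcoeff (e ^ j) x = 0" by metis
  then have Nq: "j < N" if "hcoeff (e ^ j) q \<noteq> 0" for j using that by (meson insertI1 not_le)
  have conv: "(\<Sum>a\<in>A. hcoeff (e ^ i) a * hcoeff (e ^ j) (q - a)) = hcoeff (e ^ (i + j)) q" for i j
    unfolding power_add by (rule hcoeff_mult_sum[symmetric, OF \<open>finite A\<close>]) (use powS in \<open>auto simp: A_def\<close>)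
  have "hcoeff (peval b e * peval c e) q = (\<Sum>a\<in>A. hcoeff (peval b e) a * hcoeff (peval c e) (q - a))"
    using \<open>finite A\<close> by (rule hcoeff_mult_sum) (use pevS in \<open>auto simp: A_def\<close>)
  also have "\<dots> = (\<Sum>a\<in>A. (\<Sum>i<N. fps_nth b i * hcoeff (e ^ i) a) * (\<Sum>j<N. fps_nth c j * hcoeff (e ^ j) (q - a)))"
    using N by (intro sum.cong refl arg_cong2[of _ _ _ _ "(*)"] hcoeff_peval[OF e]) auto
  also have "\<dots> = (\<Sum>a\<in>A. \<Sum>i<N. \<Sum>j<N. fps_nth b i * fps_nth c j * (hcoeff (e ^ i) a * hcoeff (e ^ j) (q - a)))"
    by (simp add: sum_product ac_simps)
  also have "\<dots> = (\<Sum>i<N. \<Sum>j<N. \<Sum>a\<in>A. fps_nth b i * fps_nth c j * (hcoeff (e ^ i) a * hcoeff (e ^ j) (q - a)))"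
    by (subst sum.swap, intro sum.cong refl, rule sum.swap)
  also have "\<dots> = (\<Sum>i<N. \<Sum>j<N. fps_nth b i * fps_nth c j * hcoeff (e ^ (i + j)) q)"
    by (simp add: sum_distrib_left[symmetric] conv)
  also have "\<dots> = (\<Sum>(i, j)\<in>{..<N} \<times> {..<N}. fps_nth b i * fps_nth c j * hcoeff (e ^ (i + j)) q)"
    by (simp add: sum.cartesian_product)
  also have "\<dots> = (\<Sum>(i, j)\<in>{(i, j). i + j < N}. fps_nth b i * fps_nth c j * hcoeff (e ^ (i + j)) q)"
    by (intro sum.mono_neutral_right) (auto intro: Nq)
  also have "\<dots> = (\<Sum>n<N. \<Sum>i\<le>n. fps_nth b i * fps_nth c (n - i) * hcoeff (e ^ (i + (n - i))) q)"
    by (rule sum.triangle_reindex)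
  also have "\<dots> = (\<Sum>n<N. fps_nth (b * c) n * hcoeff (e ^ n) q)"
    by (intro sum.cong refl) (simp add: fps_mult_nth sum_distrib_right atLeast0AtMost)
  also have "\<dots> = hcoeff (peval (b * c) e) q"
    using N by (intro hcoeff_peval[OF e, symmetric]) auto
  finally show "hcoeff (peval (b * c) e) q = hcoeff (peval b e * peval c e) q" by simp
qed

lemma peval_power:
  assumes "infinitesimal e" shows "peval (b ^ n) e = peval b e ^ n"
  by (induction n) (simp_all add: assms peval_mult)

lemma infinitesimal_peval:
  assumes e: "infinitesimal e" and b: "fps_nth b 0 = 0"
  shows "infinitesimal (peval b e)"
  unfolding infinitesimal_def
proof
  fix q assume q: "q \<in> hsupp (peval b e)"
  have "q \<le> 0"
    using e q hsupp_peval[OF e, of b]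
    by (intro span_sums_subset[of "hsupp e" "\<lambda>q. q \<le> 0" q]) (auto simp: infinitesimal_def add_nonpos_nonpos)
  moreover have "hcoeff (peval b e) 0 = 0"
  proof -
    have "hcoeff (e ^ Suc j) 0 = 0" for j
    proof (rule ccontr)
      assume "hcoeff (e ^ Suc j) 0 \<noteq> 0"
      then have "0 \<in> hsupp e + hsupp (e ^ j)" using hsupp_mult[of e "e ^ j"] by (auto simp: hsupp_def)
      then obtain x y where xy: "0 = x + y" "x \<in> hsupp e" "y \<in> hsupp (e ^ j)" by (auto elim: set_plus_elim)
      have "y \<in> span_sums (hsupp e)" using xy(3) hsupp_power[of e j] by (auto simp: span_sums_eq)
      then have "y \<le> 0"
        using e by (intro span_sums_subset[of "hsupp e" "\<lambda>q. q \<le> 0" y]) (auto simp: infinitesimal_def add_nonpos_nonpos)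
      then show False using xy e add_neg_nonpos[of x y] by (auto simp: infinitesimal_def)
    qed
    then have "hcoeff (peval b e) 0 = (\<Sum>j<1. fps_nth b j * hcoeff (e ^ j) 0)"
      by (intro hcoeff_peval[OF e]) (metis One_nat_def Suc_le_D)
    then show ?thesis using b by simp
  qed
  ultimately show "q < 0" using q by (auto simp: hsupp_def order_less_le)
qed

text \<open>
  Since \<open>b\<close> has no constant term, \<open>b\<^sup>j\<close> starts in degree \<open>j\<close>. So the bound on the powers of \<open>e\<close> that
  contribute at \<open>q\<close> also bounds the contributing powers of \<open>peval b e\<close>, and the double sum is finite.
\<close>

lemma peval_compose:
  assumes e: "infinitesimal e" and b: "fps_nth b 0 = 0"
  shows "peval a (peval b e) = peval (a oo b) e"
proof (rule hahn_eqI)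
  fix q
  obtain N where N: "\<And>j. N \<le> j \<Longrightarrow> hcoeff (e ^ j) q = 0"
    using power_coeff_bound[OF e, of "{q}"] by auto
  have low: "fps_nth (b ^ j) i = 0" if "i < j" for i j
    using b that by (simp add: startsby_zero_power_prefix)
  have pw: "hcoeff (peval b e ^ j) q = (\<Sum>i<N. fps_nth (b ^ j) i * hcoeff (e ^ i) q)" for j
    unfolding peval_power[OF e, symmetric] by (rule hcoeff_peval[OF e N])
  have "hcoeff (peval a (peval b e)) q = (\<Sum>j<N. fps_nth a j * hcoeff (peval b e ^ j) q)"
  proof (rule hcoeff_peval[OF infinitesimal_peval[OF e b]])
    fix j assume "N \<le> j"
    then show "hcoeff (peval b e ^ j) q = 0" unfolding pw using low by (intro sum.neutral) auto
  qed
  also have "\<dots> = (\<Sum>j<N. \<Sum>i<N. fps_nth a j * fps_nth (b ^ j) i * hcoeff (e ^ i) q)"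
    by (simp add: pw sum_distrib_left mult.assoc)
  also have "\<dots> = (\<Sum>i<N. \<Sum>j<N. fps_nth a j * fps_nth (b ^ j) i * hcoeff (e ^ i) q)"
    by (rule sum.swap)
  also have "\<dots> = (\<Sum>i<N. fps_nth (a oo b) i * hcoeff (e ^ i) q)"
  proof (rule sum.cong[OF refl])
    fix i assume "i \<in> {..<N}"
    then have "(\<Sum>j<N. fps_nth a j * fps_nth (b ^ j) i) = fps_nth (a oo b) i"
      unfolding fps_compose_nth by (intro sum.mono_neutral_right) (auto simp: low)
    then show "(\<Sum>j<N. fps_nth a j * fps_nth (b ^ j) i * hcoeff (e ^ i) q) = fps_nth (a oo b) i * hcoeff (e ^ i) q"
      by (simp add: sum_distrib_right[symmetric])
  qed
  also have "\<dots> = hcoeff (peval (a oo b) e) q"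
    by (rule hcoeff_peval[OF e N, symmetric])
  finally show "hcoeff (peval a (peval b e)) q = hcoeff (peval (a oo b) e) q" .
qed

text \<open>
  The identity \<open>exp (k log (1 + e)) = (1 + e)\<^sup>k\<close>, obtained from the corresponding identity of formal
  power series by composition.
\<close>

lemma peval_exp_ln_power:
  assumes e: "infinitesimal e"
  shows "peval (fps_exp 1) (of_nat k * peval (fps_ln 1) e) = (1 + e) ^ k"
proof -
  have eq: "of_nat k * peval (fps_ln 1) e = peval (fps_const (real k) * fps_ln 1) e"
    by (simp add: peval_const_mult[OF e] hconst_of_nat)
  have 1: "fps_exp 1 oo fps_ln 1 = 1 + (fps_X :: real fps)"
  proof -
    have "(fps_exp 1 - 1) oo fps_ln 1 = (fps_X :: real fps)"
      unfolding fps_ln_fps_exp_inv[OF one_neq_zero] by (rule fps_inv_right) auto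
    then show ?thesis by (simp add: fps_compose_sub_distrib algebra_simps)
  qed
  have "fps_exp 1 oo (fps_const (real k) * fps_ln 1) = (1 + fps_X) ^ k"
  proof -
    have "fps_exp 1 oo (fps_const (real k) * fps_X) = fps_exp (real k)"
      by (simp add: fps_eq_iff fps_compose_linear)
    moreover have "fps_exp 1 oo (fps_const (real k) * fps_X oo fps_ln 1)
        = fps_exp 1 oo (fps_const (real k) * fps_X) oo fps_ln 1"
      by (rule fps_compose_assoc) simp_all
    moreover have "fps_const (real k) * fps_X oo fps_ln 1 = fps_const (real k) * fps_ln (1::real)"
      by (simp flip: fps_const_mult_apply_left)
    ultimately have "fps_exp 1 oo (fps_const (real k) * fps_ln 1) = fps_exp (real k) oo fps_ln 1"
      by simp
    also have "\<dots> = (fps_exp 1 ^ k) oo fps_ln 1" by (simp add: fps_exp_power_mult)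
    also have "\<dots> = (fps_exp 1 oo fps_ln 1) ^ k" by (simp add: fps_compose_power)
    finally show ?thesis by (simp add: 1)
  qed
  then show ?thesis
    unfolding eq by (subst peval_compose[OF e]) (simp_all add: peval_power[OF e] peval_add[OF e] peval_X[OF e] e)
qed

section \<open>Leading terms and positive series\<close>

definition leading :: "'a::linordered_ab_group_add hahn \<Rightarrow> 'a \<Rightarrow> bool" where
  "leading F m \<longleftrightarrow> m \<in> hsupp F \<and> (\<forall>q\<in>hsupp F. q \<le> m)"

definition positive :: "'a::linordered_ab_group_add hahn \<Rightarrow> bool" where
  "positive F \<longleftrightarrow> (\<exists>m. leading F m \<and> 0 < hcoeff F m)"

lemma leading_unique: "leading F m \<Longrightarrow> leading F n \<Longrightarrow> m = n"
  unfolding leading_def by (meson antisym)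

lemma leading_add_smaller:
  assumes "leading F m" "\<And>q. q \<in> hsupp H \<Longrightarrow> q < m"
  shows "leading (F + H) m" "hcoeff (F + H) m = hcoeff F m"
proof -
  have "hcoeff H m = 0" using assms(2)[of m] by (auto simp: in_hsupp)
  then show *: "hcoeff (F + H) m = hcoeff F m" by simp
  have "q \<le> m" if "q \<in> hsupp (F + H)" for q
  proof -
    have "q \<in> hsupp F \<or> q \<in> hsupp H" using that hsupp_add by blast
    then show ?thesis using assms unfolding leading_def by (meson less_imp_le)
  qed
  then show "leading (F + H) m"
    using assms(1) * unfolding leading_def by (simp add: in_hsupp)
qed

lemma leading_mult:
  assumes "leading F m" "leading H n"
  shows "leading (F * H) (m + n)" "hcoeff (F * H) (m + n) = hcoeff F m * hcoeff H n"
proof -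
  have "a = m" if "hcoeff F a \<noteq> 0" "hcoeff H (m + n - a) \<noteq> 0" for a
  proof -
    have "a \<le> m" "m + n - a \<le> n" using that assms by (auto simp: leading_def in_hsupp)
    then show ?thesis by (simp add: algebra_simps)
  qed
  then have "hcoeff (F * H) (m + n) = (\<Sum>a\<in>{m}. hcoeff F a * hcoeff H (m + n - a))"
    by (intro hcoeff_mult_sum) auto
  then show *: "hcoeff (F * H) (m + n) = hcoeff F m * hcoeff H n" by simp
  have "q \<le> m + n" if "q \<in> hsupp (F * H)" for q
    using that hsupp_mult[of F H] assms unfolding leading_def by (auto elim!: set_plus_elim intro!: add_mono)
  then show "leading (F * H) (m + n)"
    using assms * by (auto simp: leading_def in_hsupp)
qed

lemma leading_exists: "F \<noteq> 0 \<Longrightarrow> \<exists>m. leading F m"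
  using revwo_max[OF revwo_hsupp[of F] order_refl] unfolding leading_def by (metis hsupp_eq_empty)

lemma positive_mult: "positive F \<Longrightarrow> positive H \<Longrightarrow> positive (F * H)"
  unfolding positive_def using leading_mult[of F _ H] by (metis mult_pos_pos)

lemma positive_add:
  assumes "positive F" "positive H" shows "positive (F + H)"
proof -
  obtain m n where m: "leading F m" "0 < hcoeff F m" and n: "leading H n" "0 < hcoeff H n"
    using assms by (auto simp: positive_def)
  consider "m < n" | "n < m" | "m = n" by fastforce
  then show ?thesis
  proof cases
    case 1
    then show ?thesis using leading_add_smaller[OF n(1), of F] m n
      unfolding positive_def leading_def by (metis add.commute order_le_less_trans)
  next
    case 2
    then show ?thesis using leading_add_smaller[OF m(1), of H] m n
      unfolding positive_def leading_def by (metis order_le_less_trans)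
  next
    case 3
    then have "0 < hcoeff (F + H) m" using m n by simp
    moreover then have "leading (F + H) m"
      using m n 3 hsupp_add[of F H] unfolding leading_def by (auto simp: in_hsupp)
    ultimately show ?thesis by (auto simp: positive_def)
  qed
qed

lemma positive_hconst: "positive (hconst c) \<longleftrightarrow> 0 < c"
proof
  assume "positive (hconst c)"
  then show "0 < c" by (auto simp: positive_def hcoeff_hconst split: if_splits)
next
  assume "0 < c"
  then show "positive (hconst c)"
    by (auto simp: positive_def leading_def in_hsupp hcoeff_hconst intro!: exI[of _ 0] split: if_splits)
qed

section \<open>The ordered group of logarithmic-exponential monomials\<close>

lemma countable_supp_graph: "countable (supp f) \<Longrightarrow> of_graph (graph_of f) = f"
proof
  fix m
  assume c: "countable (supp f)"
  have "{(m, f m) | m. m \<in> supp f} = (\<lambda>m. (m, f m)) ` supp f" by auto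
  then have "rcset (graph_of f) = {(m, f m) | m. m \<in> supp f}"
    unfolding graph_of_def using c by (intro acset_inverse) simp
  then show "of_graph (graph_of f) m = f m"
    by (auto simp: of_graph_def supp_def)
qed

lemma mon_eq_iff [simp]: "mon m = mon n \<longleftrightarrow> m = n"
  by (metis mon_def zero_neq_one)

lemma supp_mon [simp]: "supp (mon m) = {m}"
  by (auto simp: supp_def mon_def)

lemma supp_zero [simp]: "supp (\<lambda>_. 0) = {}"
  by (simp add: supp_def)

lemma mlog_mexp: "countable (supp f) \<Longrightarrow> mlog (mexp f) = f"
  by (auto simp: mexp_def countable_supp_graph)

lemma mlog_mone: "mlog mone = (\<lambda>_. 0)"
  unfolding mone_def by (simp add: mlog_mexp)

lemma LogX_less_D: "LogX i \<prec> LogX j \<Longrightarrow> j < i"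
proof (induction "LogX i" "LogX j" arbitrary: i j rule: mless.induct)
  case (exp p)
  from exp(1) have p: "p = LogX (Suc j)" "i \<noteq> j" by (auto simp: mon_def split: if_splits)
  have "Suc j < Suc i" by (rule exp(3)) (use p in \<open>auto simp: mon_def\<close>)
  then show ?case by simp
qed auto

text \<open>
  The order on monomials, read off from their logarithms: the difference has a positive leading
  coefficient.
\<close>

definition lexless :: "series \<Rightarrow> series \<Rightarrow> bool" where
  "lexless f g \<longleftrightarrow> (\<exists>p. f p < g p \<and> (\<forall>q. f q \<noteq> g q \<longrightarrow> q \<noteq> p \<longrightarrow> q \<prec> p))"

text \<open>
  The first introduction rule of \<open>\<prec>\<close> is an instance of the second one as soon as the order
  of the iterated logarithms is known.
\<close>

lemma mless_iff_lexless: "m \<prec> n \<longleftrightarrow> lexless (mlog m) (mlog n)"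
proof
  assume "m \<prec> n"
  then show "lexless (mlog m) (mlog n)"
  proof cases
    case (log i j)
    then show ?thesis
      unfolding lexless_def
      by (intro exI[of _ "LogX (Suc i)"]) (auto simp: mon_def intro: mless.log split: if_splits)
  next
    case (exp p)
    then show ?thesis unfolding lexless_def by blast
  qed
next
  assume "lexless (mlog m) (mlog n)"
  then show "m \<prec> n" unfolding lexless_def by (auto intro: mless.exp)
qed

lemma mless_asym: "m \<prec> n \<Longrightarrow> \<not> n \<prec> m"
proof (induction rule: mless.induct)
  case (log i j)
  then show ?case using LogX_less_D[of i j] by auto
next
  case (exp m p n)
  show ?case
  proof
    assume "n \<prec> m"
    then have "lexless (mlog n) (mlog m)" by (rule mless_iff_lexless[THEN iffD1])
    then obtain q where q: "mlog n q < mlog m q"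
      "\<And>r. mlog n r \<noteq> mlog m r \<Longrightarrow> r \<noteq> q \<Longrightarrow> r \<prec> q"
      unfolding lexless_def by blast
    have "q \<noteq> p" using exp(1) q(1) by auto
    then show False using exp(1) q(1) q(2)[of p] exp(2,3)[of q] by auto
  qed
qed

text \<open>
  Antisymmetry holds for \<open>\<prec>\<close> everywhere, by \<open>mless_asym\<close>; totality and transitivity have to be
  established level by level.
\<close>

definition mlinear :: "mono set \<Rightarrow> bool" where
  "mlinear T \<longleftrightarrow> (\<forall>a\<in>T. \<forall>b\<in>T. a \<noteq> b \<longrightarrow> a \<prec> b \<or> b \<prec> a) \<and>
                 (\<forall>a\<in>T. \<forall>b\<in>T. \<forall>c\<in>T. a \<prec> b \<longrightarrow> b \<prec> c \<longrightarrow> a \<prec> c)"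

text \<open>
  The possible logarithms of monomials one level above \<open>T\<close>. Countability of the support is what makes
  them recoverable from the graph that \<open>mexp\<close> stores.
\<close>

definition exponents :: "mono set \<Rightarrow> series set" where
  "exponents T = {f. countable (supp f) \<and> supp f \<subseteq> T \<and> rev_well_ordered (supp f) \<and> (\<forall>m\<in>supp f. mone \<prec> m)}"

lemma exponents_mono: "T \<subseteq> U \<Longrightarrow> exponents T \<subseteq> exponents U"
  by (auto simp: exponents_def)

lemma rev_well_ordered_subset: "rev_well_ordered A \<Longrightarrow> B \<subseteq> A \<Longrightarrow> rev_well_ordered B"
  unfolding rev_well_ordered_def by (meson order_trans)

lemma rev_well_ordered_Un:
  assumes T: "mlinear T" "A \<subseteq> T" "B \<subseteq> T" and "rev_well_ordered A" "rev_well_ordered B"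
  shows "rev_well_ordered (A \<union> B)"
  unfolding rev_well_ordered_def
proof (intro allI impI)
  fix C assume C: "C \<subseteq> A \<union> B" "C \<noteq> {}"
  have max: "(C \<inter> D = {}) \<or> (\<exists>b\<in>C \<inter> D. \<forall>a\<in>C \<inter> D. a = b \<or> a \<prec> b)" if "rev_well_ordered D" for D
    using that unfolding rev_well_ordered_def by (metis inf_le2)
  show "\<exists>b\<in>C. \<forall>a\<in>C. a = b \<or> a \<prec> b"
  proof (cases "C \<inter> A = {} \<or> C \<inter> B = {}")
    case True
    then show ?thesis using max[OF assms(4)] max[OF assms(5)] C by blast
  next
    case False
    then obtain a b where a: "a \<in> C \<inter> A" "\<forall>x\<in>C \<inter> A. x = a \<or> x \<prec> a"
      and b: "b \<in> C \<inter> B" "\<forall>x\<in>C \<inter> B. x = b \<or> x \<prec> b"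
      using max[OF assms(4)] max[OF assms(5)] by blast
    have tr: "\<And>x y z. x \<in> C \<Longrightarrow> y \<in> C \<Longrightarrow> z \<in> C \<Longrightarrow> x \<prec> y \<Longrightarrow> y \<prec> z \<Longrightarrow> x \<prec> z"
      and tot: "a = b \<or> a \<prec> b \<or> b \<prec> a"
      using T C(1) a(1) b(1) unfolding mlinear_def by blast+
    have ab: "a \<in> C" "b \<in> C" using a b by auto
    have cover: "x = a \<or> x \<prec> a \<or> x = b \<or> x \<prec> b" if "x \<in> C" for x
      using that a(2) b(2) C(1) by blast
    from tot show ?thesis
    proof (elim disjE)
      assume "a = b"
      then show ?thesis using ab cover by metis
    next
      assume "a \<prec> b"
      then show ?thesis using ab cover tr by metis
    next
      assume "b \<prec> a"
      then show ?thesis using ab cover tr by metis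
    qed
  qed
qed

lemma lexless_total:
  assumes T: "mlinear T" and f: "f \<in> exponents T" and g: "g \<in> exponents T" and "f \<noteq> g"
  shows "lexless f g \<or> lexless g f"
proof -
  have "rev_well_ordered (supp f \<union> supp g)"
    using f g by (intro rev_well_ordered_Un[OF T]) (auto simp: exponents_def)
  moreover have "{q. f q \<noteq> g q} \<subseteq> supp f \<union> supp g" "{q. f q \<noteq> g q} \<noteq> {}"
    using \<open>f \<noteq> g\<close> by (auto simp: supp_def)
  ultimately obtain p where p: "f p \<noteq> g p" "\<And>q. f q \<noteq> g q \<Longrightarrow> q = p \<or> q \<prec> p"
    unfolding rev_well_ordered_def by (metis (mono_tags, lifting) mem_Collect_eq)
  show ?thesis
  proof (cases "f p < g p")
    case True
    then show ?thesis unfolding lexless_def using p by metis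
  next
    case False
    then have "g p < f p" using p(1) by simp
    then show ?thesis unfolding lexless_def using p by metis
  qed
qed

text \<open>
  Let \<open>p\<close> and \<open>r\<close> be the leading monomials of \<open>g - f\<close> and \<open>h - g\<close>. The larger of the two is the
  leading monomial of \<open>h - f\<close>.
\<close>

lemma lexless_trans:
  assumes T: "mlinear T" and supp: "supp f \<subseteq> T" "supp g \<subseteq> T" "supp h \<subseteq> T"
    and "lexless f g" "lexless g h"
  shows "lexless f h"
proof -
  from assms(5) obtain p where p: "f p < g p" "\<And>q. f q \<noteq> g q \<Longrightarrow> q \<noteq> p \<Longrightarrow> q \<prec> p"
    unfolding lexless_def by blast
  from assms(6) obtain r where r: "g r < h r" "\<And>q. g q \<noteq> h q \<Longrightarrow> q \<noteq> r \<Longrightarrow> q \<prec> r"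
    unfolding lexless_def by blast
  have inT: "q \<in> T" if "f q \<noteq> g q \<or> g q \<noteq> h q" for q
  proof -
    from that have "f q \<noteq> 0 \<or> g q \<noteq> 0 \<or> h q \<noteq> 0" by auto
    then show ?thesis using supp by (auto simp: supp_def)
  qed
  have tr: "a \<prec> c" if "a \<prec> b" "b \<prec> c" "a \<in> T" "b \<in> T" "c \<in> T" for a b c
    using T that unfolding mlinear_def by blast
  have pr: "p \<in> T" "r \<in> T" using inT p(1) r(1) by auto
  then consider "p = r" | "p \<prec> r" | "r \<prec> p" using T unfolding mlinear_def by blast
  then show ?thesis
  proof cases
    case 1
    then have "f p < h p" using p(1) r(1) by simp
    moreover have "q \<prec> p" if "f q \<noteq> h q" "q \<noteq> p" for q
      using that p(2)[of q] r(2)[of q] 1 by metis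
    ultimately show ?thesis unfolding lexless_def by blast
  next
    case 2
    then have "f r = g r" using p(2)[of r] mless_asym by auto
    moreover have "q \<prec> r" if "f q \<noteq> h q" "q \<noteq> r" for q
    proof -
      have "q \<in> T" "q = p \<or> q \<prec> p \<or> q \<prec> r"
        using that p(2)[of q] r(2)[of q] inT[of q] by fastforce+
      then show ?thesis using 2 pr tr by blast
    qed
    ultimately show ?thesis unfolding lexless_def using r(1) by (intro exI[of _ r]) auto
  next
    case 3
    then have "g p = h p" using r(2)[of p] mless_asym by auto
    moreover have "q \<prec> p" if "f q \<noteq> h q" "q \<noteq> p" for q
    proof -
      have "q \<in> T" "q = r \<or> q \<prec> p \<or> q \<prec> r"
        using that p(2)[of q] r(2)[of q] inT[of q] by fastforce+
      then show ?thesis using 3 pr tr by blast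
    qed
    ultimately show ?thesis unfolding lexless_def using p(1) by (intro exI[of _ p]) auto
  qed
qed

lemma mlinear_exponentials:
  assumes T: "mlinear T" shows "mlinear (mexp ` exponents T)"
proof -
  have log: "mlog (mexp f) = f" if "f \<in> exponents T" for f
    using that by (intro mlog_mexp) (simp add: exponents_def)
  have less: "mexp f \<prec> mexp g \<longleftrightarrow> lexless f g" if "f \<in> exponents T" "g \<in> exponents T" for f g
    by (subst mless_iff_lexless) (simp add: log that)
  show ?thesis
    unfolding mlinear_def
  proof (intro conjI ballI impI)
    fix a b assume "a \<in> mexp ` exponents T" "b \<in> mexp ` exponents T" "a \<noteq> b"
    then obtain f g where fg: "f \<in> exponents T" "g \<in> exponents T" "a = mexp f" "b = mexp g" "f \<noteq> g"
      by blast
    then show "a \<prec> b \<or> b \<prec> a"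
      using lexless_total[OF T fg(1,2,5)] by (simp add: less)
  next
    fix a b c assume "a \<in> mexp ` exponents T" "b \<in> mexp ` exponents T" "c \<in> mexp ` exponents T" "a \<prec> b" "b \<prec> c"
    then obtain f g h where fgh: "f \<in> exponents T" "g \<in> exponents T" "h \<in> exponents T"
      "a = mexp f" "b = mexp g" "c = mexp h" and l: "lexless f g" "lexless g h"
      by (auto simp: less)
    then have "lexless f h" by (intro lexless_trans[OF T _ _ _ l]) (auto simp: exponents_def)
    then show "a \<prec> c" by (simp add: fgh less)
  qed
qed

text \<open>
  Starting from the atoms makes every level closed under taking supports of logarithms: that of
  \<open>LogX k\<close> is \<open>{LogX (Suc k)}\<close>. Therefore linearity of a level only involves linearity of
  the one before.
\<close>

primrec level :: "nat \<Rightarrow> mono set" where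
  "level 0 = range LogX"
| "level (Suc h) = mexp ` exponents (level h)"

lemma mone_less_LogX: "mone \<prec> LogX k"
  by (rule mless.exp[of _ "LogX (Suc k)"]) (auto simp: mlog_mone mon_def)

lemma level_Suc_mono: "level h \<subseteq> level (Suc h)"
proof (induction h)
  case 0
  have "LogX k = mexp (mon (LogX (Suc k)))" for k by (auto simp: mexp_def)
  moreover have "mon (LogX (Suc k)) \<in> exponents (range LogX)" for k
    by (auto simp: exponents_def mone_less_LogX rev_well_ordered_def subset_singleton_iff)
  ultimately show ?case unfolding level.simps by (intro image_subsetI image_eqI)
next
  case (Suc h)
  then show ?case using exponents_mono[OF Suc] by auto
qed

lemma level_mono: "h \<le> h' \<Longrightarrow> level h \<subseteq> level h'"
  by (induction rule: dec_induct) (use level_Suc_mono in blast)+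

lemma mlinear_level: "mlinear (level h)"
proof (induction h)
  case 0
  have "\<exists>i j. a = LogX i \<and> b = LogX j \<and> (i < j \<or> j < i)" if "a \<in> range LogX" "b \<in> range LogX" "a \<noteq> b" for a b
    using that by (auto simp: neq_iff)
  moreover have "a \<prec> c" if "a \<in> range LogX" "b \<in> range LogX" "c \<in> range LogX" "a \<prec> b" "b \<prec> c" for a b c
    using that by (auto intro!: mless.log dest!: LogX_less_D)
  ultimately show ?case unfolding mlinear_def by (metis level.simps(1) mless.log)
qed (simp add: mlinear_exponentials)

definition LEM :: "mono set" where
  "LEM = (\<Union>h. level h)"

lemma LEM_common_level2:
  assumes "a \<in> LEM" "b \<in> LEM" obtains h where "a \<in> level h" "b \<in> level h"
proof -
  from assms obtain i j where "a \<in> level i" "b \<in> level j" by (auto simp: LEM_def)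
  then show ?thesis using that[of "max i j"] level_mono by (meson max.cobounded1 max.cobounded2 subsetD)
qed

lemma mlinear_LEM: "mlinear LEM"
  unfolding mlinear_def
proof (intro conjI ballI impI)
  fix a b assume "a \<in> LEM" "b \<in> LEM" "a \<noteq> b"
  then show "a \<prec> b \<or> b \<prec> a"
    using mlinear_level unfolding mlinear_def by (metis LEM_common_level2)
next
  fix a b c assume abc: "a \<in> LEM" "b \<in> LEM" "c \<in> LEM" "a \<prec> b" "b \<prec> c"
  obtain i where "a \<in> level i" "b \<in> level i" by (rule LEM_common_level2[OF abc(1,2)])
  moreover obtain k where "c \<in> level k" using abc(3) by (auto simp: LEM_def)
  ultimately have "a \<in> level (max i k)" "b \<in> level (max i k)" "c \<in> level (max i k)"
    using level_mono by (meson max.cobounded1 max.cobounded2 subsetD)+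
  then show "a \<prec> c" using mlinear_level abc(4,5) unfolding mlinear_def by blast
qed

lemma LEM_exponents:
  assumes "m \<in> level h" shows "mlog m \<in> exponents (level h)" "mexp (mlog m) = m"
proof -
  have "m \<in> mexp ` exponents (level h)" using assms level_Suc_mono by auto
  then obtain f where "m = mexp f" "f \<in> exponents (level h)" by auto
  moreover then have "mlog m = f" by (auto simp: exponents_def mlog_mexp)
  ultimately show "mlog m \<in> exponents (level h)" "mexp (mlog m) = m" by auto
qed

lemma exponents_add:
  assumes T: "mlinear T" and f: "f \<in> exponents T" and g: "g \<in> exponents T"
  shows "(\<lambda>p. f p + g p) \<in> exponents T"
proof -
  have sub: "supp (\<lambda>p. f p + g p) \<subseteq> supp f \<union> supp g" by (auto simp: supp_def)
  moreover have "rev_well_ordered (supp f \<union> supp g)"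
    using f g by (intro rev_well_ordered_Un[OF T]) (auto simp: exponents_def)
  ultimately show ?thesis using f g
    unfolding exponents_def by (auto elim: rev_well_ordered_subset intro: countable_subset[OF sub])
qed

lemma exponents_uminus: "f \<in> exponents T \<Longrightarrow> (\<lambda>p. - f p) \<in> exponents T"
  by (simp add: exponents_def supp_def)

lemma LEM_mmult:
  assumes "m \<in> LEM" "n \<in> LEM"
  shows "mmult m n \<in> LEM" "mlog (mmult m n) = (\<lambda>p. mlog m p + mlog n p)"
proof -
  obtain h where "m \<in> level h" "n \<in> level h" using assms by (rule LEM_common_level2)
  then have *: "(\<lambda>p. mlog m p + mlog n p) \<in> exponents (level h)"
    using LEM_exponents exponents_add[OF mlinear_level] by blast
  then have "mmult m n \<in> level (Suc h)" unfolding mmult_def by simp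
  then show "mmult m n \<in> LEM" unfolding LEM_def by blast
  show "mlog (mmult m n) = (\<lambda>p. mlog m p + mlog n p)"
    unfolding mmult_def using * by (intro mlog_mexp) (simp add: exponents_def)
qed

lemma LEM_minv:
  assumes "m \<in> LEM"
  shows "minv m \<in> LEM" "mlog (minv m) = (\<lambda>p. - mlog m p)"
proof -
  obtain h where "m \<in> level h" using assms by (auto simp: LEM_def)
  then have *: "(\<lambda>p. - mlog m p) \<in> exponents (level h)"
    using LEM_exponents exponents_uminus by blast
  then have "minv m \<in> level (Suc h)" unfolding minv_def by simp
  then show "minv m \<in> LEM" unfolding LEM_def by blast
  show "mlog (minv m) = (\<lambda>p. - mlog m p)"
    unfolding minv_def using * by (intro mlog_mexp) (simp add: exponents_def)
qed

lemma LEM_mone: "mone \<in> LEM"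
proof -
  have "(\<lambda>_. 0) \<in> exponents (level 0)" by (simp add: exponents_def rev_well_ordered_def)
  then have "mone \<in> level (Suc 0)" unfolding mone_def by simp
  then show ?thesis unfolding LEM_def by blast
qed

lemma LEM_LogX: "LogX k \<in> LEM"
  unfolding LEM_def by (rule UN_I[of 0]) auto

lemma LEM_mlog_inject: "m \<in> LEM \<Longrightarrow> n \<in> LEM \<Longrightarrow> mlog m = mlog n \<Longrightarrow> m = n"
  unfolding LEM_def by (metis LEM_exponents(2) UN_E)

text \<open>
  The monomials as a type, written additively, so that the theory of Hahn series applies to them.
\<close>

typedef lemon = LEM
  morphisms rep Abs_lemon
  using LEM_mone by blast

lemma rep_LEM [simp]: "rep a \<in> LEM"
  by (rule rep)

lemma lemon_eqI: "mlog (rep a) = mlog (rep b) \<Longrightarrow> a = b"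
  by (meson LEM_mlog_inject rep_LEM rep_inject)

instantiation lemon :: linordered_ab_group_add
begin

definition zero_lemon :: lemon where "0 = Abs_lemon mone"
definition plus_lemon :: "lemon \<Rightarrow> lemon \<Rightarrow> lemon" where "a + b = Abs_lemon (mmult (rep a) (rep b))"
definition uminus_lemon :: "lemon \<Rightarrow> lemon" where "- a = Abs_lemon (minv (rep a))"
definition minus_lemon :: "lemon \<Rightarrow> lemon \<Rightarrow> lemon" where "a - b = a + - (b :: lemon)"
definition less_lemon :: "lemon \<Rightarrow> lemon \<Rightarrow> bool" where "a < b \<longleftrightarrow> rep a \<prec> rep b"
definition less_eq_lemon :: "lemon \<Rightarrow> lemon \<Rightarrow> bool" where "a \<le> b \<longleftrightarrow> a = b \<or> rep a \<prec> rep b"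

lemma rep_zero: "rep 0 = mone"
  unfolding zero_lemon_def by (simp add: Abs_lemon_inverse LEM_mone)

lemma rep_plus: "rep (a + b) = mmult (rep a) (rep b)"
  unfolding plus_lemon_def by (simp add: Abs_lemon_inverse LEM_mmult)

lemma rep_uminus: "rep (- a) = minv (rep a)"
  unfolding uminus_lemon_def by (simp add: Abs_lemon_inverse LEM_minv)

lemma mlog_rep_plus: "mlog (rep (a + b)) = (\<lambda>p. mlog (rep a) p + mlog (rep b) p)"
  by (simp add: rep_plus LEM_mmult)

lemma mlog_rep_uminus: "mlog (rep (- a)) = (\<lambda>p. - mlog (rep a) p)"
  by (simp add: rep_uminus LEM_minv)

instance
proof
  fix a b c :: lemon
  show "a + b + c = a + (b + c)" "a + b = b + a" "0 + a = a" "- a + a = 0"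
    by (rule lemon_eqI; simp add: mlog_rep_plus mlog_rep_uminus rep_zero mlog_mone add_ac)+
  show "a - b = a + - b" by (simp add: minus_lemon_def)
  show "a < b \<longleftrightarrow> a \<le> b \<and> \<not> b \<le> a"
    using mless_asym by (auto simp: less_lemon_def less_eq_lemon_def)
  show "a \<le> a" by (simp add: less_eq_lemon_def)
  show "a \<le> b \<Longrightarrow> b \<le> c \<Longrightarrow> a \<le> c"
    using mlinear_LEM unfolding less_eq_lemon_def mlinear_def by (metis rep_LEM)
  show "a \<le> b \<Longrightarrow> b \<le> a \<Longrightarrow> a = b"
    using mless_asym by (auto simp: less_eq_lemon_def)
  show "a \<le> b \<or> b \<le> a"
    using mlinear_LEM unfolding less_eq_lemon_def mlinear_def by (metis rep_LEM rep_inject)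
  show "a \<le> b \<Longrightarrow> c + a \<le> c + b"
    unfolding less_eq_lemon_def mless_iff_lexless[of "rep _"] lexless_def mlog_rep_plus by auto
qed

end

lemma rev_well_ordered_rep: "rev_well_ordered (rep ` A) \<longleftrightarrow> revwo A"
proof
  assume *: "rev_well_ordered (rep ` A)"
  show "revwo A" unfolding revwo_def
  proof (intro allI impI)
    fix B assume "B \<subseteq> A" "B \<noteq> {}"
    then have "rep ` B \<subseteq> rep ` A" "rep ` B \<noteq> {}" by auto
    from *[unfolded rev_well_ordered_def, rule_format, OF this]
    obtain b where "b \<in> B" "\<forall>a\<in>B. rep a = rep b \<or> rep a \<prec> rep b" by blast
    then show "\<exists>b\<in>B. \<forall>a\<in>B. a \<le> b" by (auto simp: less_eq_lemon_def rep_inject)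
  qed
next
  assume *: "revwo A"
  show "rev_well_ordered (rep ` A)" unfolding rev_well_ordered_def
  proof (intro allI impI)
    fix B assume B: "B \<subseteq> rep ` A" "B \<noteq> {}"
    then have "rep -` B \<subseteq> A" "rep -` B \<noteq> {}" by (auto simp: rep_inject)
    then obtain b where "b \<in> rep -` B" "\<forall>a\<in>rep -` B. a \<le> b"
      using * unfolding revwo_def by blast
    then show "\<exists>b\<in>B. \<forall>a\<in>B. a = b \<or> a \<prec> b"
      using B(1) by (intro bexI[of _ "rep b"] ballI) (fastforce simp: less_eq_lemon_def)+
  qed
qed

section \<open>Series as Hahn series over the monomial group\<close>

text \<open>
  Hahn series over the type of monomials correspond to the series with countable,
  reverse-well-ordered support in \<open>LEM\<close>, and the ring operations and the power series agree.
\<close>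

definition emb :: "lemon hahn \<Rightarrow> series" where
  "emb F = (\<lambda>m. if m \<in> LEM then hcoeff F (Abs_lemon m) else 0)"

lemma emb_rep [simp]: "emb F (rep a) = hcoeff F a"
  by (simp add: emb_def rep_inverse)

lemma emb_outside: "m \<notin> LEM \<Longrightarrow> emb F m = 0"
  by (simp add: emb_def)

lemma LEM_cases: obtains a where "m = rep a" | "m \<notin> LEM"
  by (metis Abs_lemon_inverse)

lemma emb_eqI:
  assumes "\<And>a. f (rep a) = hcoeff F a" "\<And>m. m \<notin> LEM \<Longrightarrow> f m = 0"
  shows "f = emb F"
proof
  fix m show "f m = emb F m"
    by (cases m rule: LEM_cases) (simp_all add: assms emb_outside)
qed

lemma emb_inject [simp]: "emb F = emb H \<longleftrightarrow> F = H"
  by (metis emb_rep hahn_eqI)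

lemma supp_emb: "supp (emb F) = rep ` hsupp F"
proof (intro equalityI subsetI)
  fix m assume "m \<in> supp (emb F)"
  then show "m \<in> rep ` hsupp F"
    by (cases m rule: LEM_cases) (auto simp: supp_def hsupp_def emb_outside)
qed (auto simp: supp_def hsupp_def)

lemma emb_exists:
  assumes "countable (supp f)" "supp f \<subseteq> LEM" "rev_well_ordered (supp f)"
  shows "\<exists>F. f = emb F"
proof -
  have *: "rep ` {a. f (rep a) \<noteq> 0} = supp f"
  proof (intro equalityI subsetI)
    fix m assume m: "m \<in> supp f"
    then obtain a where "m = rep a" using assms(2) by (metis LEM_cases subsetD)
    then show "m \<in> rep ` {a. f (rep a) \<noteq> 0}" using m by (auto simp: supp_def)
  qed (auto simp: supp_def)
  have "countable {a. f (rep a) \<noteq> 0}"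
    using assms(1) unfolding *[symmetric] by (rule countable_image_inj_on) (simp add: inj_on_def rep_inject)
  moreover have "revwo {a. f (rep a) \<noteq> 0}"
    using assms(3) unfolding *[symmetric] rev_well_ordered_rep .
  ultimately have "f = emb (Abs_hahn (\<lambda>a. f (rep a)))"
    using assms(2) by (intro emb_eqI) (auto simp: Abs_hahn_inverse supp_def)
  then show ?thesis by blast
qed

lemma emb_add: "emb (F + H) = emb F \<oplus> emb H"
  unfolding sadd_def by (rule emb_eqI[symmetric]) (simp_all add: emb_outside)

lemma emb_hmon: "emb (hmon a) = mon (rep a)"
  by (rule emb_eqI[symmetric]) (auto simp: mon_def hcoeff_hmon rep_inject)

lemma emb_hconst: "emb (hconst c) = sconst c"
  unfolding sconst_def mon_def
  by (rule emb_eqI[symmetric]) (use rep_inject[of _ 0] LEM_mone in \<open>auto simp: hcoeff_hconst rep_zero\<close>)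

lemma emb_one: "emb 1 = mon mone"
  using emb_hmon[of 0] by (simp add: rep_zero)

lemma emb_mult: "emb (F * H) = emb F \<otimes> emb H"
proof (rule emb_eqI[symmetric])
  fix c
  let ?A = "{x. hcoeff F x \<noteq> 0 \<and> hcoeff H (c - x) \<noteq> 0}"
  have "{(a, b). a \<in> supp (emb F) \<and> b \<in> supp (emb H) \<and> mmult a b = rep c} = (\<lambda>x. (rep x, rep (c - x))) ` ?A"
    by (auto simp: supp_emb in_hsupp rep_plus[symmetric] rep_inject image_iff)
  moreover have "inj_on (\<lambda>x. (rep x, rep (c - x))) ?A" by (auto simp: inj_on_def rep_inject)
  ultimately show "(emb F \<otimes> emb H) (rep c) = hcoeff (F * H) c"
    by (simp add: smult_def sum.reindex hcoeff_mult)
next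
  fix m assume m: "m \<notin> LEM"
  have *: "{(a, b). a \<in> supp (emb F) \<and> b \<in> supp (emb H) \<and> mmult a b = m} = {}"
    using m by (auto simp: supp_emb LEM_mmult)
  show "(emb F \<otimes> emb H) m = 0" unfolding smult_def * by simp
qed

lemma emb_power: "spower (emb F) j = emb (F ^ j)"
  by (induction j) (simp_all add: emb_one emb_mult)

lemma emb_peval:
  assumes "infinitesimal e"
  shows "spowser (fps_nth c) (emb e) = emb (peval c e)"
  unfolding spowser_def
proof (rule emb_eqI)
  fix q
  have "(\<Sum>j. fps_nth c j * spower (emb e) j (rep q)) = (\<Sum>j\<in>{j. hcoeff (e ^ j) q \<noteq> 0}. fps_nth c j * spower (emb e) j (rep q))"
    by (rule suminf_finite[OF finite_power_coeffs[OF assms]]) (simp add: emb_power)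
  then show "(\<Sum>j. fps_nth c j * spower (emb e) j (rep q)) = hcoeff (peval c e) q"
    by (simp add: emb_power peval_raw[OF assms])
qed (simp add: emb_power emb_outside)

section \<open>Logarithms of monomials\<close>

definition hlog :: "lemon \<Rightarrow> lemon hahn" where
  "hlog a = (THE F. emb F = mlog (rep a))"

lemma emb_hlog: "emb (hlog a) = mlog (rep a)"
proof -
  obtain h where h: "rep a \<in> level h" using rep_LEM[of a] by (auto simp: LEM_def)
  from LEM_exponents(1)[OF h] have "\<exists>F. mlog (rep a) = emb F"
    by (intro emb_exists) (auto simp: exponents_def LEM_def)
  then have "\<exists>!F. emb F = mlog (rep a)" by (metis emb_inject)
  then show ?thesis unfolding hlog_def by (rule theI')
qed

lemma mexp_emb_hlog: "mexp (emb (hlog a)) = rep a"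
proof -
  obtain h where h: "rep a \<in> level h" using rep_LEM[of a] by (auto simp: LEM_def)
  then show ?thesis by (simp add: emb_hlog LEM_exponents)
qed

lemma hcoeff_hlog: "hcoeff (hlog a) p = mlog (rep a) (rep p)"
  by (metis emb_hlog emb_rep)

lemma hlog_inject [simp]: "hlog a = hlog b \<longleftrightarrow> a = b"
  by (metis emb_hlog lemon_eqI)

lemma hlog_add: "hlog (a + b) = hlog a + hlog b"
  by (rule hahn_eqI) (simp add: hcoeff_hlog mlog_rep_plus)

lemma hlog_0 [simp]: "hlog 0 = 0"
  by (rule hahn_eqI) (simp add: hcoeff_hlog rep_zero mlog_mone)

lemma hlog_uminus: "hlog (- a) = - hlog a"
  by (rule hahn_eqI) (simp add: hcoeff_hlog mlog_rep_uminus)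

definition infinite_part :: "'a::linordered_ab_group_add hahn set" where
  "infinite_part = {F. hsupp F \<subseteq> {0<..}}"

lemma mone_less_rep: "mone \<prec> rep a \<longleftrightarrow> 0 < a" and rep_less_mone: "rep a \<prec> mone \<longleftrightarrow> a < 0"
  by (simp_all add: less_lemon_def rep_zero)

lemma hlog_infinite: "hlog a \<in> infinite_part"
proof -
  obtain h where h: "rep a \<in> level h" using rep_LEM[of a] by (auto simp: LEM_def)
  from LEM_exponents(1)[OF h] have "\<forall>m\<in>supp (emb (hlog a)). mone \<prec> m"
    by (simp add: emb_hlog exponents_def)
  then show ?thesis by (auto simp: infinite_part_def supp_emb mone_less_rep)
qed

text \<open>
  A bound on the level of the support is needed here, because \<open>mexp\<close> leaves \<open>LEM\<close> when the levels in
  the support are unbounded.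
\<close>

lemma hlog_surj:
  assumes "F \<in> infinite_part" "rep ` hsupp F \<subseteq> level h"
  shows "\<exists>a. hlog a = F \<and> rep a \<in> level (Suc h)"
proof -
  have *: "emb F \<in> exponents (level h)"
    using assms countable_hsupp[of F] revwo_hsupp[of F]
    by (auto simp: exponents_def supp_emb rev_well_ordered_rep infinite_part_def mone_less_rep)
  then have l: "mexp (emb F) \<in> level (Suc h)" by simp
  then obtain a where a: "rep a = mexp (emb F)" by (metis LEM_def LEM_cases UN_I UNIV_I)
  then have "emb (hlog a) = emb F"
    using * by (simp add: emb_hlog mlog_mexp exponents_def)
  then have "hlog a = F" by (simp only: emb_inject)
  then show ?thesis using l unfolding a[symmetric] by blast
qed

lemma level_add: "rep a \<in> level (Suc h) \<Longrightarrow> rep b \<in> level (Suc h) \<Longrightarrow> rep (a + b) \<in> level (Suc h)"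
proof -
  assume "rep a \<in> level (Suc h)" "rep b \<in> level (Suc h)"
  then obtain f g where fg: "rep a = mexp f" "rep b = mexp g" "f \<in> exponents (level h)" "g \<in> exponents (level h)"
    by auto
  moreover from fg have "mlog (mexp f) = f" "mlog (mexp g) = g"
    by (auto simp: exponents_def mlog_mexp)
  ultimately have "rep (a + b) = mexp (\<lambda>p. f p + g p)" by (simp add: rep_plus mmult_def)
  then show ?thesis using exponents_add[OF mlinear_level fg(3,4)] by simp
qed

lemma lemon_less_iff: "a < b \<longleftrightarrow> positive (hlog b - hlog a)"
proof
  assume "a < b"
  then obtain p where p: "mlog (rep a) p < mlog (rep b) p"
    "\<And>q. mlog (rep a) q \<noteq> mlog (rep b) q \<Longrightarrow> q \<noteq> p \<Longrightarrow> q \<prec> p"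
    unfolding less_lemon_def mless_iff_lexless[of "rep a"] lexless_def by blast
  have "p \<in> LEM" using p(1) emb_outside[of p] by (metis emb_hlog order_less_irrefl)
  then obtain r where "p = rep r" by (metis LEM_cases)
  have r: "hcoeff (hlog a) r < hcoeff (hlog b) r"
    "\<And>s. hcoeff (hlog a) s \<noteq> hcoeff (hlog b) s \<Longrightarrow> s \<le> r"
    using p \<open>p = rep r\<close> by (auto simp: hcoeff_hlog less_eq_lemon_def rep_inject[symmetric])
  then show "positive (hlog b - hlog a)"
    unfolding positive_def leading_def by (intro exI[of _ r]) (force simp: in_hsupp)
next
  assume "positive (hlog b - hlog a)"
  then obtain r where r: "leading (hlog b - hlog a) r" "hcoeff (hlog a) r < hcoeff (hlog b) r"
    by (auto simp: positive_def)
  have "q \<prec> rep r" if q: "mlog (rep a) q \<noteq> mlog (rep b) q" "q \<noteq> rep r" for q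
  proof -
    have "q \<in> LEM" using q(1) emb_outside[of q] by (metis emb_hlog)
    then obtain s where s: "q = rep s" by (metis LEM_cases)
    then have "s \<in> hsupp (hlog b - hlog a)" using q(1) by (simp add: in_hsupp hcoeff_hlog)
    then show ?thesis using r(1) q(2) s by (auto simp: leading_def less_eq_lemon_def)
  qed
  then show "a < b"
    unfolding less_lemon_def mless_iff_lexless[of "rep a"] lexless_def using r(2)
    by (intro exI[of _ "rep r"]) (auto simp: hcoeff_hlog)
qed

lemma lemon_pos_iff: "0 < a \<longleftrightarrow> positive (hlog a)"
  by (simp add: lemon_less_iff)

section \<open>Exponential, logarithm and power\<close>

text \<open>
  The hypothesis gives the three parts into which \<open>sexp\<close> splits its argument.
\<close>

lemma sexp_emb:
  assumes F: "F = hlog a + hconst r + E" and E: "infinitesimal E"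
  shows "sexp (emb F) = emb (hconst (exp r) * hmon a * peval (fps_exp 1) E)"
proof -
  have hl: "hcoeff (hlog a) q = 0" if "\<not> 0 < q" for q
    using hlog_infinite[of a] that by (auto simp: infinite_part_def in_hsupp)
  have El: "hcoeff E q = 0" if "\<not> q < 0" for q
    using E that by (auto simp: infinitesimal_def in_hsupp)
  have "emb F mone = r"
    using emb_rep[of F 0] by (simp add: rep_zero F hl El hcoeff_hconst)
  moreover have "(\<lambda>m. if mone \<prec> m then emb F m else 0) = emb (hlog a)"
    by (rule emb_eqI) (auto simp: F hl El hcoeff_hconst mone_less_rep emb_outside)
  moreover have "(\<lambda>m. if m \<prec> mone then emb F m else 0) = emb E"
    by (rule emb_eqI) (auto simp: F hl El hcoeff_hconst rep_less_mone emb_outside)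
  moreover have "(\<lambda>j. 1 / fact j :: real) = fps_nth (fps_exp 1)" by (simp add: fun_eq_iff)
  ultimately show ?thesis
    unfolding sexp_def by (simp add: mexp_emb_hlog emb_peval[OF E] emb_hmon emb_hconst emb_mult)
qed

lemma infinitesimal_remainder:
  assumes "leading F m"
  shows "infinitesimal (hconst (1 / hcoeff F m) * hmon (- m) * F - 1)"
  unfolding infinitesimal_def
proof
  fix q assume "q \<in> hsupp (hconst (1 / hcoeff F m) * hmon (- m) * F - 1)"
  then have q: "hcoeff F (q + m) / hcoeff F m - (if q = 0 then 1 else 0) \<noteq> 0"
    by (simp add: in_hsupp mult.assoc hcoeff_one)
  have "hcoeff F m \<noteq> 0" using assms by (simp add: leading_def in_hsupp)
  with q have "q \<noteq> 0" by auto
  moreover from this q have "q + m \<in> hsupp F" by (simp add: in_hsupp)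
  then have "q + m \<le> m" using assms unfolding leading_def by blast
  ultimately show "q < 0" by simp
qed

lemma lead_mono_emb:
  assumes "leading F m" shows "lead_mono (emb F) = rep m"
  unfolding lead_mono_def
proof (rule the_equality)
  show "rep m \<in> supp (emb F) \<and> (\<forall>n\<in>supp (emb F). n = rep m \<or> n \<prec> rep m)"
    using assms by (auto simp: leading_def supp_emb less_eq_lemon_def)
next
  fix p assume "p \<in> supp (emb F) \<and> (\<forall>n\<in>supp (emb F). n = p \<or> n \<prec> p)"
  then show "p = rep m"
    using assms mless_asym by (fastforce simp: leading_def supp_emb less_eq_lemon_def)
qed

lemma slog_emb:
  assumes "leading F m"
  shows "slog (emb F) = emb (hlog m + hconst (ln (hcoeff F m)) +
           peval (fps_ln 1) (hconst (1 / hcoeff F m) * hmon (- m) * F - 1))"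
proof -
  have "(\<lambda>j. if j = 0 then 0 else (- 1) ^ (j + 1) / real j) = fps_nth (fps_ln 1)"
  proof
    fix j show "(if j = 0 then 0 else (- 1) ^ (j + 1) / real j) = fps_nth (fps_ln 1) j"
      by (cases j) (auto simp: fps_ln_nth)
  qed
  moreover have "sconst (1 / hcoeff F m) \<otimes> mon (minv (rep m)) \<otimes> emb F \<oplus> sconst (- 1)
      = emb (hconst (1 / hcoeff F m) * hmon (- m) * F - 1)"
  proof -
    have "- 1 = hconst (- 1)" by (rule hahn_eqI) (simp add: hcoeff_hconst hcoeff_one)
    then have eq: "X - 1 = X + hconst (- 1)" for X :: "lemon hahn"
      by (metis diff_conv_add_uminus)
    show ?thesis unfolding eq by (simp add: emb_add emb_mult emb_hmon emb_hconst rep_uminus)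
  qed
  ultimately show ?thesis
    unfolding slog_def Let_def
    by (simp add: lead_mono_emb[OF assms] emb_peval[OF infinitesimal_remainder[OF assms]] emb_add emb_hlog emb_hconst)
qed

section \<open>Exponential towers over the integer powers of x\<close>

definition mono_x :: lemon where "mono_x = Abs_lemon (LogX 0)"

definition mono_log_x :: lemon where "mono_log_x = Abs_lemon (LogX 1)"

lemma rep_mono_x: "rep mono_x = LogX 0" and rep_mono_log_x: "rep mono_log_x = LogX 1"
  by (simp_all add: mono_x_def mono_log_x_def Abs_lemon_inverse LEM_LogX)

lemma hlog_mono_x: "hlog mono_x = hmon mono_log_x"
proof -
  have "emb (hlog mono_x) = emb (hmon mono_log_x)"
    by (simp only: emb_hlog emb_hmon rep_mono_x rep_mono_log_x mlog.simps One_nat_def)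
  then show ?thesis by (simp only: emb_inject)
qed

lemma mono_log_x_pos: "0 < mono_log_x"
  unfolding mone_less_rep[symmetric] rep_mono_log_x by (rule mone_less_LogX)

definition subgroup :: "'a::group_add set \<Rightarrow> bool" where
  "subgroup A \<longleftrightarrow> 0 \<in> A \<and> (\<forall>a\<in>A. \<forall>b\<in>A. a + b \<in> A) \<and> (\<forall>a\<in>A. - a \<in> A)"

definition over :: "'a::linordered_ab_group_add set \<Rightarrow> 'a hahn set" where
  "over A = {F. hsupp F \<subseteq> A}"

definition infinite_over :: "'a::linordered_ab_group_add set \<Rightarrow> 'a hahn set" where
  "infinite_over A = over A \<inter> infinite_part"

lemma over_add: "F \<in> over A \<Longrightarrow> H \<in> over A \<Longrightarrow> F + H \<in> over A"
  using hsupp_add[of F H] by (auto simp: over_def)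

lemma over_uminus: "F \<in> over A \<Longrightarrow> - F \<in> over A"
  by (simp add: over_def)

lemma over_minus: "F \<in> over A \<Longrightarrow> H \<in> over A \<Longrightarrow> F - H \<in> over A"
  using over_add[OF _ over_uminus, of F A H] by simp

lemma over_mult:
  assumes "\<And>a b. a \<in> A \<Longrightarrow> b \<in> A \<Longrightarrow> a + b \<in> A" "F \<in> over A" "H \<in> over A"
  shows "F * H \<in> over A"
  using assms hsupp_mult[of F H] by (fastforce simp: over_def elim: set_plus_elim)

lemma over_hconst: "0 \<in> A \<Longrightarrow> hconst c \<in> over A"
  using hsupp_hconst[of c] by (auto simp: over_def)

lemma over_zero: "0 \<in> over A"
  by (simp add: over_def)

lemma over_hmon: "a \<in> A \<Longrightarrow> hmon a \<in> over A"
  by (simp add: over_def)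

lemma over_peval:
  assumes "0 \<in> A" "\<And>a b. a \<in> A \<Longrightarrow> b \<in> A \<Longrightarrow> a + b \<in> A" "e \<in> over A" "infinitesimal e"
  shows "peval b e \<in> over A"
proof -
  have "q \<in> A" if "q \<in> span_sums (hsupp e)" for q
    by (rule span_sums_subset[OF _ _ _ that]) (use assms in \<open>auto simp: over_def\<close>)
  then show ?thesis using hsupp_peval[OF assms(4), of b] by (auto simp: over_def)
qed

lemma infinite_part_eq_over: "infinite_part = over {0<..}"
  by (simp add: infinite_part_def over_def)

lemma infinite_over_zero: "0 \<in> infinite_over A"
  by (simp add: infinite_over_def infinite_part_eq_over over_zero)

lemma infinite_over_add: "F \<in> infinite_over A \<Longrightarrow> H \<in> infinite_over A \<Longrightarrow> F + H \<in> infinite_over A"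
  by (simp add: infinite_over_def infinite_part_eq_over over_add)

lemma infinite_over_uminus: "F \<in> infinite_over A \<Longrightarrow> - F \<in> infinite_over A"
  by (simp add: infinite_over_def infinite_part_eq_over over_uminus)

lemma infinite_over_hconst_mult: "F \<in> infinite_over A \<Longrightarrow> hconst c * F \<in> infinite_over A"
  by (auto simp: infinite_over_def infinite_part_def over_def hsupp_def)

lemma infinite_over_mult:
  "subgroup A \<Longrightarrow> F \<in> infinite_over A \<Longrightarrow> H \<in> infinite_over A \<Longrightarrow> F * H \<in> infinite_over A"
  unfolding infinite_over_def infinite_part_eq_over
  by (auto intro!: over_mult simp: subgroup_def add_pos_pos)

lemma infinite_over_mono: "A \<subseteq> B \<Longrightarrow> infinite_over A \<subseteq> infinite_over B"
  by (auto simp: infinite_over_def over_def)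

lemma infinite_plus_const_mult:
  assumes "subgroup A" "g \<in> infinite_over A" "h \<in> infinite_over A"
  shows "(g + hconst c) * (h + hconst d) - hconst (c * d) \<in> infinite_over A"
proof -
  have "(g + hconst c) * (h + hconst d) - hconst (c * d) = g * h + hconst d * g + hconst c * h"
    by (simp add: hconst_mult algebra_simps)
  then show ?thesis using assms
    by (auto intro!: infinite_over_add infinite_over_mult infinite_over_hconst_mult)
qed

text \<open>
  The counterpart of \<open>G n\<close> in which all series have countable support. Membership is expressed
  through the logarithm: \<open>log (exp \<gamma> x\<^sup>\<theta>\<^sup>+\<^sup>k) = \<gamma> + (\<theta> + k) log x\<close>.
\<close>

primrec skolem_group :: "nat \<Rightarrow> lemon set" where
  "skolem_group 0 = {m. \<exists>k::int. hlog m = hconst (of_int k) * hmon mono_log_x}"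
| "skolem_group (Suc n) = {m. \<exists>\<gamma>\<in>infinite_over (skolem_group n). \<exists>\<theta>\<in>infinite_over (skolem_group n). \<exists>k::int.
     hlog m = \<gamma> + (\<theta> + hconst (of_int k)) * hmon mono_log_x}"

lemma hconst_uminus: "hconst (- c) = - hconst c"
  by (rule hahn_eqI) (simp add: hcoeff_hconst)

lemma subgroup_skolem_group: "subgroup (skolem_group n)"
proof (cases n)
  case 0
  have "hlog 0 = hconst (of_int 0) * hmon mono_log_x" by simp
  moreover have "hlog (a + b) = hconst (of_int (i + j)) * hmon mono_log_x"
    if "hlog a = hconst (of_int i) * hmon mono_log_x" "hlog b = hconst (of_int j) * hmon mono_log_x" for a b i j
    by (simp add: hlog_add that hconst_add algebra_simps)
  moreover have "hlog (- a) = hconst (of_int (- i)) * hmon mono_log_x"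
    if "hlog a = hconst (of_int i) * hmon mono_log_x" for a i
    by (simp add: hlog_uminus that hconst_uminus)
  ultimately show ?thesis unfolding subgroup_def 0 skolem_group.simps by blast
next
  case (Suc l)
  let ?I = "infinite_over (skolem_group l)"
  let ?F = "\<lambda>\<gamma> \<theta> k. \<gamma> + (\<theta> + hconst (of_int k)) * hmon mono_log_x"
  have "hlog 0 = ?F 0 0 0" by simp
  then have zero: "0 \<in> skolem_group n" unfolding Suc skolem_group.simps using infinite_over_zero by blast
  have add: "hlog (a + b) = ?F (\<gamma> + \<gamma>') (\<theta> + \<theta>') (i + j)"
    if "hlog a = ?F \<gamma> \<theta> i" "hlog b = ?F \<gamma>' \<theta>' j" for a b \<gamma> \<gamma>' \<theta> \<theta>' i j
    by (simp add: hlog_add that hconst_add algebra_simps)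
  have minus: "hlog (- a) = ?F (- \<gamma>) (- \<theta>) (- i)" if "hlog a = ?F \<gamma> \<theta> i" for a \<gamma> \<theta> i
    by (simp add: hlog_uminus that hconst_uminus algebra_simps)
  have "a + b \<in> skolem_group n" if ab: "a \<in> skolem_group n" "b \<in> skolem_group n" for a b
  proof -
    obtain \<gamma> \<theta> \<gamma>' \<theta>' i j where *: "\<gamma> \<in> ?I" "\<theta> \<in> ?I" "\<gamma>' \<in> ?I" "\<theta>' \<in> ?I" "hlog a = ?F \<gamma> \<theta> i" "hlog b = ?F \<gamma>' \<theta>' j"
      using ab unfolding Suc by auto
    show ?thesis unfolding Suc skolem_group.simps
      using add[OF *(5,6)] infinite_over_add[OF *(1,3)] infinite_over_add[OF *(2,4)] by blast
  qed
  moreover have "- a \<in> skolem_group n" if a: "a \<in> skolem_group n" for a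
  proof -
    obtain \<gamma> \<theta> i where *: "\<gamma> \<in> ?I" "\<theta> \<in> ?I" "hlog a = ?F \<gamma> \<theta> i"
      using a unfolding Suc by auto
    show ?thesis unfolding Suc skolem_group.simps
      using minus[OF *(3)] infinite_over_uminus[OF *(1)] infinite_over_uminus[OF *(2)] by blast
  qed
  ultimately show ?thesis using zero by (auto simp: subgroup_def)
qed

lemma zero_in_skolem_group: "0 \<in> skolem_group n"
  and add_in_skolem_group: "a \<in> skolem_group n \<Longrightarrow> b \<in> skolem_group n \<Longrightarrow> a + b \<in> skolem_group n"
  using subgroup_skolem_group[of n] by (auto simp: subgroup_def)

lemma skolem_group_Suc: "skolem_group n \<subseteq> skolem_group (Suc n)"
proof (induction n)
  case 0
  have "hlog m = 0 + (0 + hconst (of_int k)) * hmon mono_log_x" if "hlog m = hconst (of_int k) * hmon mono_log_x" for m k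
    using that by simp
  then show ?case using infinite_over_zero unfolding skolem_group.simps by blast
next
  case (Suc n)
  then show ?case using infinite_over_mono[OF Suc] by (subst (1 2) skolem_group.simps(2)) blast
qed

lemma skolem_group_mono: "n \<le> n' \<Longrightarrow> skolem_group n \<subseteq> skolem_group n'"
  by (induction rule: dec_induct) (use skolem_group_Suc in blast)+

lemma exponent_infinite:
  assumes "\<gamma> \<in> infinite_part" "\<theta> \<in> infinite_part"
  shows "\<gamma> + (\<theta> + hconst c) * hmon mono_log_x \<in> infinite_part"
proof -
  have "\<theta> * hmon mono_log_x \<in> infinite_part" "hconst c * hmon mono_log_x \<in> infinite_part"
    using assms mono_log_x_pos over_mult[of "{0<..}" \<theta> "hmon mono_log_x"]
    by (auto simp: infinite_part_eq_over over_hmon add_pos_pos) (auto simp: over_def in_hsupp hcoeff_hmon split: if_splits)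
  then show ?thesis
    using assms by (auto simp: infinite_part_eq_over distrib_right intro!: over_add)
qed

lemma exponent_supp:
  assumes "\<gamma> \<in> over A" "\<theta> \<in> over A" "0 \<in> A"
  shows "hsupp (\<gamma> + (\<theta> + hconst c) * hmon mono_log_x) \<subseteq> A \<union> (\<lambda>a. a + mono_log_x) ` A"
proof
  fix q assume "q \<in> hsupp (\<gamma> + (\<theta> + hconst c) * hmon mono_log_x)"
  then have "q \<in> hsupp \<gamma> \<or> q \<in> hsupp (\<theta> + hconst c) + hsupp (hmon mono_log_x)"
    using hsupp_add hsupp_mult by blast
  moreover have "hsupp (\<theta> + hconst c) \<subseteq> A"
    using over_add[OF assms(2) over_hconst[OF assms(3)]] by (auto simp: over_def)
  ultimately show "q \<in> A \<union> (\<lambda>a. a + mono_log_x) ` A"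
    using assms(1) by (auto simp: over_def elim!: set_plus_elim)
qed

lemma mono_log_x_level: "rep mono_log_x \<in> level h"
  using level_mono[of 0 h] by (auto simp: rep_mono_log_x)

lemma exponent_level:
  assumes "rep ` A \<subseteq> level (Suc h)" "\<gamma> \<in> over A" "\<theta> \<in> over A" "0 \<in> A"
  shows "rep ` hsupp (\<gamma> + (\<theta> + hconst c) * hmon mono_log_x) \<subseteq> level (Suc h)"
  using exponent_supp[OF assms(2-4), of c] assms(1) level_add[OF _ mono_log_x_level] by blast

lemma skolem_group_level: "rep ` skolem_group n \<subseteq> level (Suc n)"
proof (induction n)
  case 0
  show ?case
  proof clarsimp
    fix m k assume m: "hlog m = hconst (real_of_int k) * hmon mono_log_x"
    then have "rep ` hsupp (hlog m) \<subseteq> level 0"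
      by (auto simp: in_hsupp hcoeff_hmon rep_mono_log_x split: if_splits)
    from hlog_surj[OF hlog_infinite this] show "rep m \<in> mexp ` exponents (range LogX)" by simp
  qed
next
  case (Suc n)
  show ?case
  proof
    fix p assume "p \<in> rep ` skolem_group (Suc n)"
    then obtain m \<gamma> \<theta> k where m: "p = rep m" "hlog m = \<gamma> + (\<theta> + hconst (of_int k)) * hmon mono_log_x"
      "\<gamma> \<in> infinite_over (skolem_group n)" "\<theta> \<in> infinite_over (skolem_group n)" by auto
    then have "rep ` hsupp (hlog m) \<subseteq> level (Suc n)"
      using exponent_level[OF Suc] zero_in_skolem_group by (simp add: infinite_over_def)
    from hlog_surj[OF hlog_infinite this] show "p \<in> level (Suc (Suc n))" using m(1) by simp
  qed
qed

lemma skolem_group_exists: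
  assumes "\<gamma> \<in> infinite_over (skolem_group n)" "\<theta> \<in> infinite_over (skolem_group n)"
  obtains m where "hlog m = \<gamma> + (\<theta> + hconst (of_int k)) * hmon mono_log_x" "m \<in> skolem_group (Suc n)"
proof -
  have "\<gamma> + (\<theta> + hconst (of_int k)) * hmon mono_log_x \<in> infinite_part"
    using assms by (intro exponent_infinite) (auto simp: infinite_over_def)
  moreover have "rep ` hsupp (\<gamma> + (\<theta> + hconst (of_int k)) * hmon mono_log_x) \<subseteq> level (Suc n)"
    using assms zero_in_skolem_group by (intro exponent_level[OF skolem_group_level]) (auto simp: infinite_over_def)
  ultimately obtain m where "hlog m = \<gamma> + (\<theta> + hconst (of_int k)) * hmon mono_log_x"
    using hlog_surj by blast
  then show ?thesis using that[of m] assms by auto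
qed

section \<open>Closure under powers\<close>

text \<open>
  The invariant of the induction. Positivity is needed for logarithms to make sense.
\<close>

definition skolem_form :: "nat \<Rightarrow> lemon hahn \<Rightarrow> bool" where
  "skolem_form n F \<longleftrightarrow> positive F \<and> (\<exists>g\<in>infinite_over (skolem_group n). \<exists>k::nat. F = g + hconst (real k))"

lemma skolem_form_mono: "skolem_form n F \<Longrightarrow> n \<le> n' \<Longrightarrow> skolem_form n' F"
  unfolding skolem_form_def using infinite_over_mono[OF skolem_group_mono] by blast

lemma skolem_form_add: "skolem_form n F \<Longrightarrow> skolem_form n H \<Longrightarrow> skolem_form n (F + H)"
proof -
  assume "skolem_form n F" "skolem_form n H"
  then obtain g h k l where *: "positive F" "positive H" "g \<in> infinite_over (skolem_group n)" "h \<in> infinite_over (skolem_group n)"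
    "F = g + hconst (real k)" "H = h + hconst (real l)" by (auto simp: skolem_form_def)
  then have "F + H = (g + h) + hconst (real (k + l))" by (simp add: hconst_add)
  then show ?thesis unfolding skolem_form_def
    using * positive_add infinite_over_add by blast
qed

lemma skolem_form_mult: "skolem_form n F \<Longrightarrow> skolem_form n H \<Longrightarrow> skolem_form n (F * H)"
proof -
  assume "skolem_form n F" "skolem_form n H"
  then obtain g h k l where *: "positive F" "positive H" "g \<in> infinite_over (skolem_group n)" "h \<in> infinite_over (skolem_group n)"
    "F = g + hconst (real k)" "H = h + hconst (real l)" by (auto simp: skolem_form_def)
  have "F * H - hconst (real k * real l) \<in> infinite_over (skolem_group n)"
    unfolding *(5,6) by (rule infinite_plus_const_mult[OF subgroup_skolem_group *(3,4)])
  moreover have "F * H = (F * H - hconst (real k * real l)) + hconst (real (k * l))" by simp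
  ultimately show ?thesis unfolding skolem_form_def
    using * positive_mult by blast
qed

lemma skolem_form_hconst: "0 < k \<Longrightarrow> skolem_form n (hconst (real k))"
  unfolding skolem_form_def positive_hconst using infinite_over_zero by (metis add_0 of_nat_0_less_iff)

lemma skolem_form_power: "skolem_form n F \<Longrightarrow> skolem_form n (F ^ k)"
proof (induction k)
  case 0
  then show ?case using skolem_form_hconst[of 1 n] by simp
qed (simp add: skolem_form_mult)

lemma positive_hmon: "positive (hmon a)"
  by (auto simp: positive_def leading_def hcoeff_hmon intro!: exI[of _ a])

lemma skolem_form_hmon:
  assumes "a \<in> skolem_group n" "0 < a" shows "skolem_form n (hmon a)"
proof -
  have "hmon a \<in> infinite_over (skolem_group n)"
    using assms by (auto simp: infinite_over_def over_def infinite_part_def)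
  moreover have "hmon a = hmon a + hconst (real 0)" by simp
  ultimately show ?thesis unfolding skolem_form_def using positive_hmon by blast
qed

lemma leading_infinite_plus_const:
  assumes "g \<in> infinite_part" "g \<noteq> 0"
  obtains m where "0 < m" "leading (g + hconst c) m" "leading g m" "hcoeff (g + hconst c) m = hcoeff g m"
proof -
  obtain m where m: "leading g m" using leading_exists[OF assms(2)] by blast
  then have "0 < m" using assms(1) by (auto simp: leading_def infinite_part_def)
  then show ?thesis using that m leading_add_smaller[OF m, of "hconst c"] hsupp_hconst[of c] by blast
qed

lemma spow_emb:
  assumes "leading U m"
  shows "spow (emb U) (emb V) = sexp (emb (V * (hlog m + hconst (ln (hcoeff U m)) +
           peval (fps_ln 1) (hconst (1 / hcoeff U m) * hmon (- m) * U - 1))))"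
  unfolding spow_def slog_emb[OF assms] by (simp add: emb_mult)

lemma infinitesimal_zero [simp]: "infinitesimal 0"
  by (simp add: infinitesimal_def)

text \<open>
  With \<open>V = g + k\<close> one gets \<open>c\<^sup>V = c\<^sup>k exp (g log c)\<close>, and \<open>g log c\<close> is purely infinite. The
  exponential is an infinite monomial, or \<open>1\<close> if \<open>c = 1\<close> or \<open>g = 0\<close>; in the latter case the constant
  term is the natural number \<open>c\<^sup>k\<close>.
\<close>

lemma skolem_form_const_power:
  assumes c: "0 < c" and V: "skolem_form n V"
  shows "\<exists>W. skolem_form (Suc n) W \<and> spow (emb (hconst (real c))) (emb V) = emb W"
proof -
  obtain g k where g: "g \<in> infinite_over (skolem_group n)" and Vg: "V = g + hconst (real k)" and pos: "positive V"
    using V by (auto simp: skolem_form_def)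
  have "leading (hconst (real c)) (0 :: lemon)"
    using c by (auto simp: leading_def in_hsupp hcoeff_hconst split: if_splits)
  moreover have "hconst (1 / real c) * hmon (- 0) * hconst (real c) - 1 = (0 :: lemon hahn)"
    using c by (simp add: hconst_mult[symmetric])
  ultimately have 1: "spow (emb (hconst (real c))) (emb V) = sexp (emb (V * hconst (ln (real c))))"
    using spow_emb[of "hconst (real c)" 0 V] by (simp add: hcoeff_hconst)
  obtain a where "hlog a = hconst (ln (real c)) * g + (0 + hconst (of_int 0)) * hmon mono_log_x"
    and aG: "a \<in> skolem_group (Suc n)"
    by (rule skolem_group_exists[OF infinite_over_hconst_mult[OF g] infinite_over_zero])
  then have a: "hlog a = hconst (ln (real c)) * g" by simp
  have "V * hconst (ln (real c)) = hlog a + hconst (real k * ln (real c)) + 0"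
    by (simp add: a Vg hconst_mult algebra_simps)
  from sexp_emb[OF this] have 2: "sexp (emb (V * hconst (ln (real c)))) = emb (hconst (real (c ^ k)) * hmon a)"
    using c by (simp add: exp_of_nat_mult)
  have "skolem_form (Suc n) (hconst (real (c ^ k)) * hmon a)"
  proof (cases "a = 0")
    case True
    then show ?thesis using c skolem_form_hconst[of "c ^ k"] by simp
  next
    case False
    then have "hlog a \<noteq> 0" using hlog_inject[of a 0] by simp
    then have ln: "ln (real c) \<noteq> 0" "g \<noteq> 0" using a by auto
    then have "0 < ln (real c)" using c by (cases "c = 1") auto
    moreover have "positive g"
      using leading_infinite_plus_const[of g "real k"] g ln(2) pos leading_unique[of V]
      unfolding Vg positive_def infinite_over_def by (metis IntD2)
    ultimately have "0 < a" unfolding lemon_pos_iff a by (intro positive_mult) (simp_all add: positive_hconst)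
    then show ?thesis using aG c by (intro skolem_form_mult skolem_form_hconst skolem_form_hmon) auto
  qed
  then show ?thesis using 1 2 by auto
qed

lemma hlog_multiple: "\<exists>a. hlog a = of_nat k * hlog m \<and> hmon a = hmon m ^ k"
proof (induction k)
  case 0
  show ?case by (intro exI[of _ 0]) simp
next
  case (Suc k)
  then obtain a where "hlog a = of_nat k * hlog m" "hmon a = hmon m ^ k" by blast
  then show ?case by (intro exI[of _ "m + a"]) (simp add: hlog_add hmon_add algebra_simps)
qed

text \<open>
  Here it matters that \<open>exp (k log U)\<close> really is the \<open>k\<close>-fold product. The support of the formal
  exponential alone does not prevent monomials below \<open>1\<close>; the binomial identity cancels them.
\<close>

lemma spow_nat:
  assumes lead: "leading U m" and pos: "0 < hcoeff U m"
  shows "spow (emb U) (emb (hconst (real k))) = emb (U ^ k)"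
proof -
  define c where "c = hcoeff U m"
  define e where "e = hconst (1 / c) * hmon (- m) * U - 1"
  define L where "L = peval (fps_ln 1) e"
  have c: "c > 0" using pos by (simp add: c_def)
  have e: "infinitesimal e" unfolding e_def c_def by (rule infinitesimal_remainder[OF lead])
  have L: "infinitesimal L" unfolding L_def by (rule infinitesimal_peval[OF e]) simp
  obtain a where a: "hlog a = of_nat k * hlog m" "hmon a = hmon m ^ k" using hlog_multiple by blast
  have kL: "infinitesimal (of_nat k * L)"
    using L by (auto simp: infinitesimal_def in_hsupp simp flip: hconst_of_nat)
  have "hconst (real k) * (hlog m + hconst (ln c) + L) = hlog a + hconst (real k * ln c) + of_nat k * L"
    by (simp add: a hconst_of_nat hconst_mult algebra_simps)
  from sexp_emb[OF this kL]
  have "sexp (emb (hconst (real k) * (hlog m + hconst (ln c) + L)))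
      = emb (hconst (c ^ k) * hmon m ^ k * (1 + e) ^ k)"
    using c by (simp add: exp_of_nat_mult a L_def peval_exp_ln_power[OF e])
  also have "hconst (c ^ k) * hmon m ^ k * (1 + e) ^ k = (hconst c * hmon m * (1 + e)) ^ k"
    by (simp add: power_mult_distrib hconst_power)
  also have "hconst c * hmon m * (1 + e) = (hconst c * hconst (1 / c)) * (hmon m * hmon (- m)) * U"
    by (simp add: e_def algebra_simps)
  also have "\<dots> = U"
    using c by (simp flip: hconst_mult hmon_add)
  finally show ?thesis
    unfolding spow_emb[OF lead] by (simp add: c_def e_def L_def)
qed

lemma positive_one_plus_infinitesimal:
  assumes "infinitesimal E" shows "positive (1 + E)"
proof -
  have "leading (1 :: 'a hahn) 0" by (simp add: leading_def)
  from leading_add_smaller[OF this, of E] assms show ?thesis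
    by (auto simp: positive_def infinitesimal_def hcoeff_one intro!: exI[of _ 0])
qed

lemma positive_exp_infinitesimal:
  assumes "infinitesimal E" shows "positive (peval (fps_exp 1) E)"
proof -
  have "peval (fps_exp 1) E = peval (1 + (fps_exp 1 - 1)) E" by simp
  also have "\<dots> = 1 + peval (fps_exp 1 - 1) E" by (simp only: peval_add[OF assms] peval_1[OF assms])
  finally show ?thesis
    by (simp add: positive_one_plus_infinitesimal infinitesimal_peval[OF assms])
qed

text \<open>
  Let \<open>U = c m (1 + e)\<close>. The support of \<open>U\<close> is \<open>\<ge> 1\<close>, hence that of \<open>e\<close> is \<open>\<ge> 1 / m\<close>. Consequently all
  monomials of \<open>log (1 + e)\<close>, of the infinitesimal part \<open>E\<close> of \<open>V log U\<close>, and of \<open>exp E\<close> are above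
  some power of \<open>1 / m\<close>. On the other hand \<open>M = exp ((V log U)\<up>)\<close> exceeds all powers of \<open>m\<close>, because \<open>V\<close>
  is infinite and so the leading term of \<open>V log U\<close> dominates that of \<open>log m\<close>. Hence \<open>M exp E\<close>
  is purely infinite.

  Moreover, if \<open>log m = \<gamma> + (\<theta> + j) log x\<close>, then \<open>V log U = D + V (\<theta> + j) log x\<close> where \<open>D\<close> is a series over
  the same group as \<open>U\<close> and \<open>V\<close>, while \<open>V (\<theta> + j)\<close> is purely infinite up to an integer constant. This is
  the shape that is required for \<open>M\<close> to lie in the next group.
\<close>

lemma skolem_form_infinite_power:
  assumes U: "U = g + hconst (real k)" "g \<in> infinite_over (skolem_group n)" "g \<noteq> 0" "positive U"
    and V: "V = h + hconst (real l)" "h \<in> infinite_over (skolem_group n)" "h \<noteq> 0" "positive V"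
  shows "\<exists>W. skolem_form (Suc n) W \<and> spow (emb U) (emb V) = emb W"
proof -
  define A where "A = skolem_group n"
  have A: "subgroup A" unfolding A_def by (rule subgroup_skolem_group)
  have A0: "0 \<in> A" and Aadd: "\<And>a b. a \<in> A \<Longrightarrow> b \<in> A \<Longrightarrow> a + b \<in> A" and Am: "\<And>a. a \<in> A \<Longrightarrow> - a \<in> A"
    using A by (auto simp: subgroup_def)
  have g: "g \<in> over A" "g \<in> infinite_part" and h: "h \<in> over A" "h \<in> infinite_part"
    using U V by (auto simp: infinite_over_def A_def)
  obtain m where m: "0 < m" "leading U m" using leading_infinite_plus_const[OF g(2) U(3)] U(1) by metis
  obtain p where p: "0 < p" "leading V p" using leading_infinite_plus_const[OF h(2) V(3)] V(1) by metis
  define c where "c = hcoeff U m"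
  have c: "0 < c" using U(4) m(2) leading_unique unfolding c_def positive_def by blast
  have p': "0 < hcoeff V p" using V(4) p(2) leading_unique unfolding positive_def by blast
  have overA: "U \<in> over A" "V \<in> over A" using U(1) V(1) g h A0 by (auto intro: over_add over_hconst)
  have nn: "U \<in> over {0..}" "V \<in> over {0..}"
  proof -
    have "infinite_part \<subseteq> over {0..}" by (auto simp: infinite_part_def over_def)
    then show "U \<in> over {0..}" "V \<in> over {0..}" using U(1) V(1) g h by (auto intro!: over_add over_hconst)
  qed
  have mA: "m \<in> A" using m(2) overA by (auto simp: leading_def over_def)
  \<comment> \<open>Moving up one level makes the decomposition of \<open>log m\<close> available also for \<open>n = 0\<close>.\<close>
  then have "m \<in> skolem_group (Suc n)" using skolem_group_Suc A_def by blast
  then obtain \<gamma> \<theta> and j :: int where \<gamma>: "\<gamma> \<in> infinite_over A" "\<theta> \<in> infinite_over A"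
    and hm: "hlog m = \<gamma> + (\<theta> + hconst (of_int j)) * hmon mono_log_x"
    by (auto simp: A_def)
  define e where "e = hconst (1 / c) * hmon (- m) * U - 1"
  define L where "L = peval (fps_ln 1) e"
  have e: "infinitesimal e" unfolding e_def c_def by (rule infinitesimal_remainder[OF m(2)])
  have L: "infinitesimal L" unfolding L_def by (rule infinitesimal_peval[OF e]) simp
  have eA: "e \<in> over A"
    unfolding e_def using overA mA Am A0 Aadd
    by (intro over_minus over_mult over_hconst over_hmon) (auto simp: over_def)
  have LA: "L \<in> over A" unfolding L_def by (rule over_peval[OF A0 Aadd eA e])
  define D where "D = V * (\<gamma> + hconst (ln c)) + V * L"
  have DA: "D \<in> over A" unfolding D_def
    using overA LA \<gamma> A0 Aadd by (intro over_add over_mult over_hconst) (auto simp: infinite_over_def)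
  define B where "B = V * (\<theta> + hconst (of_int j)) - hconst (real l * of_int j)"
  have B: "B \<in> infinite_over A"
    unfolding B_def V(1) using infinite_plus_const_mult[OF A] V(2) \<gamma>(2) A_def by blast
  define E where "E = hrestrict {..<0} D"
  have E: "infinitesimal E" by (simp add: E_def infinitesimal_def)
  have "hrestrict {0<..} D \<in> infinite_over A"
    using DA by (auto simp: infinite_over_def over_def infinite_part_def)
  then obtain M where M: "hlog M = hrestrict {0<..} D + (B + hconst (of_int (int l * j))) * hmon mono_log_x"
      "M \<in> skolem_group (Suc n)"
    using skolem_group_exists B unfolding A_def by metis
  define F where "F = V * (hlog m + (hconst (ln c) + L))"
  have Dsplit: "D = hrestrict {0<..} D + hconst (hcoeff D 0) + E"
    by (rule hahn_eqI) (auto simp: E_def hcoeff_hconst)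
  have "F = D + (B + hconst (of_int (int l * j))) * hmon mono_log_x"
    by (simp add: F_def D_def B_def hm algebra_simps)
  then have F: "F = hlog M + hconst (hcoeff D 0) + E"
    unfolding M(1) by (subst (asm) Dsplit) (simp add: algebra_simps)
  define W where "W = hconst (exp (hcoeff D 0)) * hmon M * peval (fps_exp 1) E"
  have spow: "spow (emb U) (emb V) = emb W"
    using sexp_emb[OF F E] unfolding spow_emb[OF m(2)] W_def F_def
    by (simp add: c_def e_def L_def add.assoc)

  \<comment> \<open>The exponent of \<open>M\<close> is dominated by the product of the leading terms of \<open>V\<close> and \<open>log U\<close>.\<close>
  have big: "a < M" if a: "hlog a = of_nat i * hlog m" for a i
  proof -
    obtain w where w: "leading (hlog m) w" "0 < hcoeff (hlog m) w"
      using m(1) by (auto simp: lemon_pos_iff positive_def)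
    have "0 < w" using w(1) hlog_infinite[of m] by (auto simp: leading_def infinite_part_def)
    have small: "q < w" if "q \<in> hsupp (hconst (ln c) + L)" for q
      using that hsupp_add[of "hconst (ln c)" L] hsupp_hconst[of "ln c"] L \<open>0 < w\<close>
      by (fastforce simp: infinitesimal_def)
    have W: "leading (hlog m + (hconst (ln c) + L)) w"
      "hcoeff (hlog m + (hconst (ln c) + L)) w = hcoeff (hlog m) w"
      by (rule leading_add_smaller[OF w(1)], erule small)+
    have lF: "leading F (p + w)" unfolding F_def by (rule leading_mult(1)[OF p(2) W(1)])
    have cF: "0 < hcoeff F (p + w)"
      unfolding F_def leading_mult(2)[OF p(2) W(1)] W(2) using p' w(2) by simp
    have "q < p + w" if q: "q \<in> hsupp (- (hconst (hcoeff D 0) + E + of_nat i * hlog m))" for q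
    proof -
      have "q \<in> hsupp (hconst (hcoeff D 0)) \<or> q \<in> hsupp E \<or> q \<in> hsupp (hconst (real i) * hlog m)"
        using q hsupp_add[of "hconst (hcoeff D 0) + E" "of_nat i * hlog m"] hsupp_add[of "hconst (hcoeff D 0)" E]
        unfolding hsupp_uminus by (auto simp: hconst_of_nat)
      moreover have "hsupp (hconst (real i) * hlog m) \<subseteq> hsupp (hlog m)" by (auto simp: hsupp_def)
      ultimately have "q \<le> 0 \<or> q \<le> w"
        using hsupp_hconst[of "hcoeff D 0"] E w(1) unfolding infinitesimal_def leading_def
        by (blast intro: less_imp_le)
      then show ?thesis using p(1) \<open>0 < w\<close> add_pos_pos[of p w] by (auto simp: add_strict_increasing order_le_less_trans)
    qed
    note * = leading_add_smaller[OF lF, of "- (hconst (hcoeff D 0) + E + of_nat i * hlog m)", OF this]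
    have "positive (F + - (hconst (hcoeff D 0) + E + of_nat i * hlog m))"
      unfolding positive_def using * cF by (intro exI[of _ "p + w"]) (simp only: simp_thms)
    moreover have "F + - (hconst (hcoeff D 0) + E + of_nat i * hlog m) = hlog M - hlog a"
      by (simp add: F a algebra_simps)
    ultimately show "a < M" by (simp add: lemon_less_iff)
  qed

  \<comment> \<open>The monomials above some power of \<open>1 / m\<close>; a multiple of \<open>m\<close> is described by its logarithm.\<close>
  define low where "low = {q. \<exists>a i. hlog a = of_nat i * hlog m \<and> 0 \<le> q + a}"
  have low0: "q \<in> low" if "0 \<le> q" for q
    unfolding low_def using that by (intro CollectI exI[of _ 0]) simp
  have lowadd: "q + r \<in> low" if qr: "q \<in> low" "r \<in> low" for q r
  proof -
    obtain a b i j where *: "hlog a = of_nat i * hlog m" "0 \<le> q + a" "hlog b = of_nat j * hlog m" "0 \<le> r + b"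
      using qr by (auto simp: low_def)
    then have "hlog (a + b) = of_nat (i + j) * hlog m" by (simp add: hlog_add algebra_simps)
    moreover have "0 \<le> q + r + (a + b)" using add_nonneg_nonneg[OF *(2,4)] by (simp add: algebra_simps)
    ultimately show ?thesis unfolding low_def by blast
  qed
  have elow: "e \<in> over low"
  proof -
    have "q \<in> low" if "q \<in> hsupp e" for q
    proof -
      have "q \<noteq> 0" using that e by (auto simp: infinitesimal_def)
      then have "q + m \<in> hsupp U" using that by (auto simp: e_def in_hsupp mult.assoc hcoeff_one)
      then have "0 \<le> q + m" using nn(1) by (auto simp: over_def)
      moreover have "hlog m = of_nat 1 * hlog m" by simp
      ultimately show ?thesis unfolding low_def by blast
    qed
    then show ?thesis by (auto simp: over_def)
  qed
  have nnlow: "over {0..} \<subseteq> over low" using low0 by (auto simp: over_def)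
  have "\<gamma> \<in> over {0..}" using \<gamma>(1) by (auto simp: infinite_over_def infinite_part_def over_def)
  then have Dlow: "D \<in> over low" unfolding D_def L_def
    using nn(2) nnlow low0 by (intro over_add over_mult over_peval lowadd elow e over_hconst) auto
  then have "E \<in> over low" by (auto simp: E_def over_def)
  then have expE: "peval (fps_exp 1) E \<in> over low"
    using lowadd E low0[OF order_refl] by (intro over_peval)
  have "E \<in> over A" using DA by (auto simp: E_def over_def)
  then have expA: "peval (fps_exp 1) E \<in> over A" by (intro over_peval A0 Aadd E) auto
  have "W \<in> infinite_over (skolem_group (Suc n))"
  proof -
    have "0 < q \<and> q \<in> skolem_group (Suc n)" if "q \<in> hsupp W" for q
    proof -
      have q: "q - M \<in> hsupp (peval (fps_exp 1) E)"
        using that by (simp add: W_def in_hsupp mult.assoc)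
      then have "q - M \<in> skolem_group (Suc n)" using expA skolem_group_Suc[of n] by (auto simp: over_def A_def)
      from add_in_skolem_group[OF this M(2)] have "q \<in> skolem_group (Suc n)" by simp
      moreover have "q - M \<in> low" using q expE by (auto simp: over_def)
      then obtain a i where "hlog a = of_nat i * hlog m" "0 \<le> q - M + a" by (auto simp: low_def)
      then have "M - a \<le> q" "a < M" using big by (auto simp: algebra_simps)
      then have "0 < q" by (meson diff_gt_0_iff_gt order_less_le_trans)
      ultimately show ?thesis by simp
    qed
    then show ?thesis by (auto simp: infinite_over_def over_def infinite_part_def)
  qed
  moreover have "positive W"
    unfolding W_def by (intro positive_mult positive_hmon positive_exp_infinitesimal E) (simp add: positive_hconst)
  moreover have "W = W + hconst (real 0)" by simp
  ultimately have "skolem_form (Suc n) W" unfolding skolem_form_def by blast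
  then show ?thesis using spow by blast
qed

lemma skolem_form_spow:
  assumes "skolem_form n U" "skolem_form n V"
  shows "\<exists>W. skolem_form (Suc n) W \<and> spow (emb U) (emb V) = emb W"
proof -
  obtain g k where U: "U = g + hconst (real k)" "g \<in> infinite_over (skolem_group n)" "positive U"
    using assms(1) by (auto simp: skolem_form_def)
  obtain h l where V: "V = h + hconst (real l)" "h \<in> infinite_over (skolem_group n)" "positive V"
    using assms(2) by (auto simp: skolem_form_def)
  consider "g = 0" | "h = 0" | "g \<noteq> 0" "h \<noteq> 0" by blast
  then show ?thesis
  proof cases
    case 1
    then have "0 < k" "U = hconst (real k)" using U by (auto simp: positive_hconst)
    then show ?thesis using skolem_form_const_power[OF _ assms(2)] by simp
  next
    case 2
    obtain m where m: "leading U m" "0 < hcoeff U m" using U(3) by (auto simp: positive_def)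
    have "spow (emb U) (emb V) = emb (U ^ l)" using spow_nat[OF m] V(1) 2 by simp
    moreover have "skolem_form (Suc n) (U ^ l)"
      using skolem_form_mono[OF skolem_form_power[OF assms(1)]] by simp
    ultimately show ?thesis by blast
  next
    case 3
    then show ?thesis using skolem_form_infinite_power U V by blast
  qed
qed

lemma interp_skolem_form: "interp f s \<Longrightarrow> \<exists>n F. skolem_form n F \<and> s = emb F"
proof (induction rule: interp.induct)
  case one
  show ?case using skolem_form_hconst[of 1 0] emb_hconst[of 1] by (metis of_nat_1 zero_less_one)
next
  case id
  have "mono_x \<in> skolem_group 0" by (simp add: hlog_mono_x) (rule exI[of _ 1], simp)
  moreover have "0 < mono_x" unfolding mone_less_rep[symmetric] rep_mono_x by (rule mone_less_LogX)
  moreover have "sX = emb (hmon mono_x)" by (simp add: sX_def emb_hmon rep_mono_x)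
  ultimately show ?case using skolem_form_hmon by blast
next
  case (add f s g t)
  then obtain n F n' H where *: "skolem_form n F" "skolem_form n' H" "s = emb F" "t = emb H" by blast
  then have "skolem_form (max n n') (F + H)"
    by (intro skolem_form_add) (auto elim: skolem_form_mono)
  then show ?case unfolding * emb_add[symmetric] by blast
next
  case (mult f s g t)
  then obtain n F n' H where *: "skolem_form n F" "skolem_form n' H" "s = emb F" "t = emb H" by blast
  then have "skolem_form (max n n') (F * H)"
    by (intro skolem_form_mult) (auto elim: skolem_form_mono)
  then show ?case unfolding * emb_mult[symmetric] by blast
next
  case (pow f s g t)
  then obtain n F n' H where *: "skolem_form n F" "skolem_form n' H" "s = emb F" "t = emb H" by blast
  have "skolem_form (max n n') F" "skolem_form (max n n') H" using * by (auto elim: skolem_form_mono)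
  then show ?case using skolem_form_spow unfolding * by blast
qed

section \<open>Embedding into the monomial groups of K and of the LE-series\<close>

lemma sexp_hlog: "sexp (emb (hlog a)) = mon (rep a)"
  using sexp_emb[of "hlog a" a 0 0] by (simp add: emb_hmon)

lemma spow_sX:
  assumes "hlog b = V * hmon mono_log_x"
  shows "spow sX (emb V) = mon (rep b)"
proof -
  have 1: "leading (hmon mono_x) mono_x" by (simp add: leading_def)
  have "hmon (- mono_x) * hmon mono_x = (1 :: lemon hahn)" by (simp flip: hmon_add)
  then have "spow (emb (hmon mono_x)) (emb V) = sexp (emb (V * hlog mono_x))"
    unfolding spow_emb[OF 1] by (simp add: hcoeff_hmon)
  then show ?thesis using sexp_hlog[of b] by (simp add: assms hlog_mono_x emb_hmon rep_mono_x sX_def)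
qed

lemma emb_in_Hahn: "rep ` hsupp F \<subseteq> A \<Longrightarrow> emb F \<in> Hahn A"
  by (simp add: Hahn_def supp_emb rev_well_ordered_rep revwo_hsupp)

lemma emb_in_pure_inf:
  assumes "F \<in> infinite_part" "rep ` hsupp F \<subseteq> A" shows "emb F \<in> pure_inf (Hahn A)"
  using emb_in_Hahn[OF assms(2)] assms(1)
  by (auto simp: pure_inf_def supp_emb mone_less_rep infinite_part_def)

lemma skolem_group_G: "rep ` skolem_group n \<subseteq> G n"
proof (induction n)
  case 0
  have "mon (rep m) = spow sX (sconst (real_of_int k))" if "hlog m = hconst (of_int k) * hmon mono_log_x" for m k
    using spow_sX[OF that] by (simp add: emb_hconst)
  then show ?case by auto
next
  case (Suc n)
  show ?case
  proof
    fix q assume "q \<in> rep ` skolem_group (Suc n)"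
    then obtain m \<gamma> \<theta> and k :: int where m: "q = rep m" "\<gamma> \<in> infinite_over (skolem_group n)" "\<theta> \<in> infinite_over (skolem_group n)"
      "hlog m = \<gamma> + (\<theta> + hconst (of_int k)) * hmon mono_log_x" by auto
    obtain a where a: "hlog a = \<gamma>" using skolem_group_exists[OF m(2) infinite_over_zero, of 0] by auto
    obtain b where b: "hlog b = (\<theta> + hconst (of_int k)) * hmon mono_log_x"
      using skolem_group_exists[OF infinite_over_zero m(3), of k] by auto
    have "hlog m = hlog (a + b)" by (simp add: m a b hlog_add)
    then have "emb (hmon m) = emb (hmon a) \<otimes> emb (hmon b)"
      unfolding hlog_inject by (simp add: hmon_add emb_mult)
    then have "mon q = sexp (emb \<gamma>) \<otimes> spow sX (emb \<theta> \<oplus> sconst (of_int k))"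
      using sexp_hlog[of a] spow_sX[OF b] by (simp add: a m(1) emb_hmon emb_add emb_hconst)
    moreover have "emb F \<in> pure_inf (Hahn (G n))" if "F \<in> infinite_over (skolem_group n)" for F
      using that Suc by (intro emb_in_pure_inf) (auto simp: infinite_over_def over_def)
    ultimately show "q \<in> G (Suc n)" using m(2,3) by (simp only: G.simps) blast
  qed
qed

lemma emb_hlog_mono_log_x: "emb (hlog mono_log_x) = mon (LogX 2)"
  by (simp add: emb_hlog rep_mono_log_x numeral_2_eq_2)

lemma LEmon_SucI:
  "f \<in> pure_inf (Hahn (LEmon k h)) \<Longrightarrow> mexp (\<lambda>p. r * mon (LogX (Suc k)) p + f p) \<in> LEmon k (Suc h)"
  by auto

text \<open>
  With \<open>y = log x\<close>, the logarithms of the elements of \<open>skolem_group n\<close> are series over \<open>\<MM>\<^sub>n(y)\<close>. The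
  term \<open>(\<theta> + k) log x\<close> is the reason why these groups have to be closed under multiplication by \<open>y\<close>.
\<close>

lemma skolem_group_log_LE:
  "m \<in> skolem_group n \<Longrightarrow> emb (hlog m) \<in> pure_inf (Hahn (LEmon 1 n))"
proof (induction n arbitrary: m)
  case 0
  then obtain k :: int where k: "hlog m = hconst (of_int k) * hmon mono_log_x" by auto
  have "LogX 1 = mexp (\<lambda>p. 1 * mon (LogX (Suc 1)) p)" by (auto simp: mexp_def)
  then have "LogX 1 \<in> LEmon 1 0" unfolding LEmon.simps by (intro CollectI exI[of _ 1] conjI TrueI)
  then have "{LogX 1} \<subseteq> LEmon 1 0" by (rule insert_subsetI[OF _ empty_subsetI])
  moreover have "rep ` hsupp (hlog m) \<subseteq> {LogX 1}"
    using rep_mono_log_x by (auto simp: k in_hsupp hcoeff_hmon split: if_splits)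
  ultimately show ?case by (intro emb_in_pure_inf hlog_infinite) (rule subset_trans)
next
  case (Suc n)
  note inLE = LEmon_SucI[of _ 1 n]
  have 1: "rep a \<in> LEmon 1 (Suc n)" if "a \<in> skolem_group n" for a
    using inLE[OF Suc.IH[OF that], of 0] by (simp add: mexp_emb_hlog)
  have 2: "rep (a + mono_log_x) \<in> LEmon 1 (Suc n)" if "a \<in> skolem_group n" for a
  proof -
    have "emb (hlog (a + mono_log_x)) = (\<lambda>p. 1 * mon (LogX (Suc 1)) p + emb (hlog a) p)"
      by (simp add: hlog_add emb_add emb_hlog_mono_log_x sadd_def add.commute numeral_2_eq_2)
    then show ?thesis using inLE[OF Suc.IH[OF that], of 1] by (metis mexp_emb_hlog)
  qed
  obtain \<gamma> \<theta> and k :: int where "\<gamma> \<in> infinite_over (skolem_group n)" "\<theta> \<in> infinite_over (skolem_group n)"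
    and m: "hlog m = \<gamma> + (\<theta> + hconst (of_int k)) * hmon mono_log_x" using Suc.prems by auto
  then have "hsupp (hlog m) \<subseteq> skolem_group n \<union> (\<lambda>a. a + mono_log_x) ` skolem_group n"
    unfolding m using zero_in_skolem_group by (intro exponent_supp) (auto simp: infinite_over_def)
  then show ?case using 1 2 by (intro emb_in_pure_inf hlog_infinite) blast
qed

lemma skolem_group_LE: "rep ` skolem_group n \<subseteq> LEmon 1 (Suc n)"
proof
  fix q assume "q \<in> rep ` skolem_group n"
  then obtain m where m: "q = rep m" "m \<in> skolem_group n" by blast
  have "q = mexp (\<lambda>p. 0 * mon (LogX (Suc 1)) p + emb (hlog m) p)"
    by (simp add: m mexp_emb_hlog)
  also have "\<dots> \<in> LEmon 1 (Suc n)" by (rule LEmon_SucI[OF skolem_group_log_LE[OF m(2)]])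
  finally show "q \<in> LEmon 1 (Suc n)" .
qed

lemma Sk_interp: "f \<in> Sk \<Longrightarrow> \<exists>s. interp f s"
  by (induction rule: Sk.induct) (blast intro: interp.intros)+

theorem theorem6p4:
  fixes f :: germ
  assumes "f \<in> Sk"
  shows "(\<exists>s. interp f s) \<and>
    (\<forall>s. interp f s \<longrightarrow>
        s \<in> LE \<and>
        (\<exists>g \<in> pure_inf K. \<exists>n::nat. s = g \<oplus> sconst (real n)) \<and>
        (\<forall>m \<in> supp s. \<not> m \<prec> mone) \<and>
        (\<exists>n::nat. s mone = real n))"
proof (intro conjI allI impI ballI)
  show "\<exists>s. interp f s" using assms by (rule Sk_interp)
next
  fix s assume "interp f s"
  from interp_skolem_form[OF this] obtain n F g and k :: nat where s: "s = emb F"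
    and g: "g \<in> over (skolem_group n)" "g \<in> infinite_part" and F: "F = g + hconst (real k)"
    by (auto simp: skolem_form_def infinite_over_def)
  have "F \<in> over (skolem_group n)"
    unfolding F using g zero_in_skolem_group by (intro over_add over_hconst)
  then have "rep ` hsupp F \<subseteq> LEmon 1 (Suc n)"
    using skolem_group_LE unfolding over_def by blast
  then show "s \<in> LE" unfolding s LE_def by (intro UN_I[of 1] UN_I[of "Suc n"] emb_in_Hahn UNIV_I)
  have "emb g \<in> pure_inf (Hahn (G n))"
    using g skolem_group_G by (intro emb_in_pure_inf) (auto simp: over_def)
  then have "emb g \<in> pure_inf K" unfolding pure_inf_def K_def by blast
  moreover have "s = emb g \<oplus> sconst (real k)" by (simp add: s F emb_add emb_hconst)
  ultimately show "\<exists>g\<in>pure_inf K. \<exists>n::nat. s = g \<oplus> sconst (real n)" by blast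
  have g0: "hcoeff g a = 0" if "\<not> 0 < a" for a
    using g(2) that by (auto simp: infinite_part_def in_hsupp)
  show "\<not> m \<prec> mone" if "m \<in> supp s" for m
    using that g0 by (auto simp: s supp_emb rep_less_mone in_hsupp F hcoeff_hconst split: if_splits)
  have "s mone = real k"
    using emb_rep[of F 0] by (simp add: s rep_zero F g0 hcoeff_hconst)
  then show "\<exists>n::nat. s mone = real n" by blast
qed

end
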